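(* Let $A$ be a $C^*$-algebra, let $\mathcal{M}$ be a Hilbert $A$-module, and let $T:\mathcal{M}\to\mathcal{M}$ be an injective bounded module map. The following conditions are equivalent: (i) $T$ is conformal; (ii) $T=\lambda U$ for some non-zero positive $\lambda\in\mathbb{R}$ and some isometric module operator $U$ on $\mathcal{M}$.
   Context: $C^*$-algebras are not assumed unital. A Hilbert $A$-module $\mathcal{M}$ is a left $A$-module (with compatible complex linear structure) equipped with an $A$-valued inner product $\langle\cdot,\cdot\rangle:\mathcal{M}\times\mathcal{M}\to A$ that is $A$-linear in the first variable, satisfies $\langle x,y\rangle=\langle y,x\rangle^*$ and $\langle x,x\rangle\ge 0$ with equality iff $x=0$, and such that $\mathcal{M}$ is complete in the norm $\|x\|=\|\langle x,x\rangle\|^{1/2}$. A bounded module map is a bounded $A$-linear (and complex linear) map; an isometric module operator $U$ on $\mathcal{M}$ is a module map $U:\mathcal{M}\to\mathcal{M}$ with $\|Ux\|=\|x\|$ for all $x\in\mathcal{M}$ (not necessarily surjective). An injective bounded module map $T$ on $\mathcal{M}$ is conformal if \[ \frac{\|\langle Tx,Ty\rangle\|}{\|Tx\|\,\|Ty\|}=\frac{\|\langle x,y\rangle\|}{\|x\|\,\|y\|} \] holds for all non-zero $x,y\in\mathcal{M}$. *)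

theory Defs
  imports Complex_Main
begin

class complex_banach = banach +
  fixes scaleC :: "complex \<Rightarrow> 'a \<Rightarrow> 'a"  (infixr "*\<^sub>C" 75)
  assumes scaleC_add_right: "c *\<^sub>C (x + y) = c *\<^sub>C x + c *\<^sub>C y"
    and scaleC_add_left: "(c + d) *\<^sub>C x = c *\<^sub>C x + d *\<^sub>C x"
    and scaleC_scaleC: "c *\<^sub>C d *\<^sub>C x = (c * d) *\<^sub>C x"
    and scaleC_of_real: "of_real r *\<^sub>C x = r *\<^sub>R x"
    and norm_scaleC: "norm (c *\<^sub>C x) = norm c * norm x"

(* Neither class below provides a unit, so non-unital algebras (and the zero algebra) are included. *)
class cstar_algebra = complex_banach + real_normed_algebra +
  fixes star :: "'a \<Rightarrow> 'a"
  assumes mult_scaleC_left: "(c *\<^sub>C a) * b = c *\<^sub>C (a * b)"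
    and mult_scaleC_right: "a * (c *\<^sub>C b) = c *\<^sub>C (a * b)"
    and star_add: "star (a + b) = star a + star b"
    and star_scaleC: "star (c *\<^sub>C a) = cnj c *\<^sub>C star a"
    and star_mult: "star (a * b) = star b * star a"
    and star_star: "star (star a) = a"
    and cstar_identity: "norm (star a * a) = (norm a)\<^sup>2"

definition positive_element :: "'a::cstar_algebra \<Rightarrow> bool"
  where "positive_element a \<longleftrightarrow> (\<exists>b. a = star b * b)"

(* The norm of the type 'm is tied to the inner product by norm_eq_sqrt_inner; completeness in
   this norm is the completeness of the class complex_banach. *)
locale hilbert_module =
  fixes act :: "'a::cstar_algebra \<Rightarrow> 'm::complex_banach \<Rightarrow> 'm"
    and inn :: "'m \<Rightarrow> 'm \<Rightarrow> 'a"
  assumes act_add_right: "act a (x + y) = act a x + act a y"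
    and act_add_left: "act (a + b) x = act a x + act b x"
    and act_mult: "act (a * b) x = act a (act b x)"
    and act_scaleC_left: "act (c *\<^sub>C a) x = c *\<^sub>C act a x"
    and act_scaleC_right: "act a (c *\<^sub>C x) = c *\<^sub>C act a x"
    and inner_add_left: "inn (x + y) z = inn x z + inn y z"
    and inner_scaleC_left: "inn (c *\<^sub>C x) y = c *\<^sub>C inn x y"
    and inner_act_left: "inn (act a x) y = a * inn x y"
    and inner_commute: "inn x y = star (inn y x)"
    and inner_positive: "positive_element (inn x x)"
    and inner_eq_zero_iff: "inn x x = 0 \<longleftrightarrow> x = 0"
    and norm_eq_sqrt_inner: "norm x = sqrt (norm (inn x x))"

definition module_map :: "('a::cstar_algebra \<Rightarrow> 'm::complex_banach \<Rightarrow> 'm) \<Rightarrow> ('m \<Rightarrow> 'm) \<Rightarrow> bool"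
  where "module_map act T \<longleftrightarrow>
    (\<forall>x y. T (x + y) = T x + T y) \<and>
    (\<forall>c x. T (c *\<^sub>C x) = c *\<^sub>C T x) \<and>
    (\<forall>a x. T (act a x) = act a (T x))"

definition bounded_module_map ::
    "('a::cstar_algebra \<Rightarrow> 'm::complex_banach \<Rightarrow> 'm) \<Rightarrow> ('m \<Rightarrow> 'm) \<Rightarrow> bool"
  where "bounded_module_map act T \<longleftrightarrow>
    module_map act T \<and> (\<exists>K. \<forall>x. norm (T x) \<le> K * norm x)"

definition isometric_module_operator ::
    "('a::cstar_algebra \<Rightarrow> 'm::complex_banach \<Rightarrow> 'm) \<Rightarrow> ('m \<Rightarrow> 'm) \<Rightarrow> bool"
  where "isometric_module_operator act U \<longleftrightarrow>
    module_map act U \<and> (\<forall>x. norm (U x) = norm x)"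

definition conformal ::
    "('a::cstar_algebra \<Rightarrow> 'm::complex_banach \<Rightarrow> 'm) \<Rightarrow> ('m \<Rightarrow> 'm \<Rightarrow> 'a) \<Rightarrow> ('m \<Rightarrow> 'm) \<Rightarrow> bool"
  where "conformal act inn T \<longleftrightarrow>
    bounded_module_map act T \<and> inj T \<and>
    (\<forall>x y. x \<noteq> 0 \<longrightarrow> y \<noteq> 0 \<longrightarrow>
      norm (inn (T x) (T y)) / (norm (T x) * norm (T y)) = norm (inn x y) / (norm x * norm y))"

end

theory Submission
  imports Defs "HOL-Analysis.Bounded_Linear_Function" "HOL-Analysis.Complex_Transcendental"
begin

text \<open>Write \<open>h = \<langle>x, x\<rangle>\<close>, \<open>k = \<langle>Tx, Tx\<rangle>\<close> and \<open>r x = \<parallel>Tx\<parallel> / \<parallel>x\<parallel>\<close>.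

  (ii) implies (i): if \<open>U\<close> is isometric, then \<open>\<parallel>R \<langle>Ux, Ux\<rangle> R\<parallel> = \<parallel>R h R\<parallel>\<close> for
  \<open>R = (h + e)\<^sup>-\<^sup>1\<^sup>/\<^sup>2\<close>, which gives \<open>\<langle>Ux, Ux\<rangle> \<le> h + e\<close>; by symmetry \<open>\<langle>Ux, Ux\<rangle> = h\<close>,
  and \<open>U\<close> preserves inner products by polarization.

  (i) implies (ii): conformality reads \<open>\<parallel>\<langle>Tx, Ty\<rangle>\<parallel> = r x r y \<parallel>\<langle>x, y\<rangle>\<parallel>\<close>, in particular
  \<open>\<parallel>\<langle>Tx, Ty\<rangle>\<parallel> \<le> C \<parallel>\<langle>x, y\<rangle>\<parallel>\<close>. Applied to \<open>e\<^sup>z\<^sup>h x\<close> and to the image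
  of \<open>x\<close> under the adjoint of \<open>e\<^sup>-\<^sup>z\<^sup>h\<close>, this bounds the entire function \<open>e\<^sup>z\<^sup>h k e\<^sup>-\<^sup>z\<^sup>h\<close>, so \<open>h\<close> and \<open>k\<close> commute. For invertible \<open>P\<close>, \<open>Q\<close>
  commuting with both, the conformality of the pairs \<open>(Px, Qx)\<close> and \<open>(PQx, x)\<close> shows
  \<open>r (Px) r (Qx) = r (PQx) r x\<close>, and boundedness of \<open>r\<close> forces \<open>r (Px) = r x\<close>. With \<open>P = (h + e)\<^sup>-\<^sup>1\<^sup>/\<^sup>2\<close>
  and \<open>P = (k + e)\<^sup>-\<^sup>1\<^sup>/\<^sup>2\<close> the argument above yields \<open>k = (r x)\<^sup>2 h\<close>. Approximate orthogonal
  projection of \<open>y\<close> onto the submodule generated by \<open>x\<close> extends this to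
  \<open>\<langle>Tx, Ty\<rangle> = (r x)\<^sup>2 \<langle>x, y\<rangle>\<close>, whence \<open>r\<close> is constant.\<close>

section \<open>Unital \<open>C\<^sup>*\<close>-algebras\<close>

lemma scaleC_one [simp]: "1 *\<^sub>C x = x"
  using scaleC_of_real[of 1 x] by simp

lemma scaleC_zero_right [simp]: "c *\<^sub>C (0::'a::complex_banach) = 0"
  using norm_scaleC[of c "0::'a"] by simp

lemma scaleC_minus_right: "c *\<^sub>C (- x) = - (c *\<^sub>C x)"
  by (metis add.right_inverse minus_unique scaleC_add_right scaleC_zero_right)

lemma scaleC_diff_right: "c *\<^sub>C (x - y) = c *\<^sub>C x - c *\<^sub>C y"
  by (metis diff_conv_add_uminus scaleC_add_right scaleC_minus_right)

lemma scaleC_zero_left [simp]: "0 *\<^sub>C x = 0"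
  using scaleC_of_real[of 0 x] by simp

lemma scaleC_minus_left: "(- c) *\<^sub>C x = - (c *\<^sub>C x)"
  by (metis add.right_inverse minus_unique scaleC_add_left scaleC_zero_left)

lemma scaleC_scaleR: "c *\<^sub>C r *\<^sub>R x = r *\<^sub>R c *\<^sub>C x"
  by (metis mult.commute scaleC_of_real scaleC_scaleC)

lemma scaleC_sum_right: "c *\<^sub>C sum f A = (\<Sum>i\<in>A. c *\<^sub>C f i)"
  by (induction A rule: infinite_finite_induct) (auto simp: scaleC_add_right)

lemma scaleC_sum_left: "sum f A *\<^sub>C x = (\<Sum>i\<in>A. f i *\<^sub>C x)"
  by (induction A rule: infinite_finite_induct) (auto simp: scaleC_add_left)

lemma star_zero [simp]: "star 0 = (0::'a::cstar_algebra)"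
  by (metis add_cancel_right_right star_add)

lemma star_minus: "star (- a) = - star (a::'a::cstar_algebra)"
  by (metis add.right_inverse minus_unique star_add star_zero)

lemma star_diff: "star (a - b) = star a - star (b::'a::cstar_algebra)"
  by (metis diff_conv_add_uminus star_add star_minus)

lemma star_scaleR: "star (r *\<^sub>R a) = r *\<^sub>R star (a::'a::cstar_algebra)"
  by (metis complex_cnj_complex_of_real scaleC_of_real star_scaleC)

lemma norm_star: "norm (star a) = norm (a::'a::cstar_algebra)"
proof -
  have le: "norm b \<le> norm (star b)" for b :: 'a
  proof (cases "b = 0")
    case False
    have "norm b * norm b \<le> norm (star b) * norm b"
      using cstar_identity[of b] norm_mult_ineq[of "star b" b] by (simp add: power2_eq_square)
    then show ?thesis using False by simp
  qed simp
  show ?thesis using le[of a] le[of "star a"] by (simp add: star_star)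
qed

lemma cstar_identity': "norm (a * star a) = (norm (a::'a::cstar_algebra))\<^sup>2"
  using cstar_identity[of "star a"] by (simp add: star_star norm_star)

lemma norm_selfadjoint_square: "star a = a \<Longrightarrow> norm (a * a) = (norm (a::'a::cstar_algebra))\<^sup>2"
  using cstar_identity[of a] by simp

section \<open>Unital algebras: norms of powers and square roots\<close>

class unital_cstar_algebra = cstar_algebra + monoid_mult

lemma star_one [simp]: "star 1 = (1::'a::unital_cstar_algebra)"
  by (metis mult_1_left mult_1_right star_mult star_star)

lemma norm_one_le: "norm (1::'a::unital_cstar_algebra) \<le> 1"
  using norm_selfadjoint_square[of "1::'a"] by (cases "norm (1::'a) = 0") (simp_all add: power2_eq_square)

lemma norm_power_le: "norm (a ^ n) \<le> norm (a::'a::unital_cstar_algebra) ^ n"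
proof (induction n)
  case (Suc n)
  have "norm (a ^ Suc n) \<le> norm a * norm (a ^ n)" using norm_mult_ineq by simp
  also have "\<dots> \<le> norm a * norm a ^ n" using Suc by (simp add: mult_left_mono)
  finally show ?case by simp
qed (simp add: norm_one_le)

lemma power_commute_left:
  fixes a :: "'a::monoid_mult"
  assumes "c * a = b * c" shows "c * a ^ n = b ^ n * c"
proof (induction n)
  case (Suc n)
  have "c * a ^ Suc n = (c * a) * a ^ n" by (simp add: mult.assoc)
  also have "\<dots> = b * (c * a ^ n)" by (simp add: assms mult.assoc)
  finally show ?case using Suc by (simp add: mult.assoc)
qed simp

lemma star_power: "star ((a::'a::unital_cstar_algebra) ^ n) = star a ^ n"
  by (induction n) (simp_all add: star_mult power_commutes)

text \<open>Repeated squaring iterates the C*-identity; this stands in for the spectral radius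
  formula.\<close>

lemma norm_selfadjoint_power:
  fixes a :: "'a::unital_cstar_algebra"
  assumes "star a = a"
  shows "norm (a ^ 2 ^ m) = norm a ^ 2 ^ m"
proof (induction m)
  case (Suc m)
  have "norm (a ^ 2 ^ Suc m) = norm (a ^ 2 ^ m * a ^ 2 ^ m)" by (simp add: power_add mult_2)
  also have "\<dots> = (norm (a ^ 2 ^ m))\<^sup>2"
    by (rule norm_selfadjoint_square) (simp add: star_power assms)
  also have "\<dots> = norm a ^ 2 ^ Suc m" using Suc by (simp add: power2_eq_square power_add mult_2)
  finally show ?case .
qed simp

text \<open>The square root is \<open>1 - y\<close> with \<open>y\<close> the limit of \<open>y \<mapsto> (q + y\<^sup>2) / 2\<close>; the increments are
  dominated by those of the same scalar iteration with \<open>q = 1\<close>.\<close>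

lemma sqrt_one_minus:
  fixes q :: "'a::unital_cstar_algebra"
  assumes sa: "star q = q" and nq: "norm q \<le> 1"
  obtains s where "star s = s" "s * s = 1 - q" "norm (1 - s) \<le> 1"
    "\<And>c. c * q = q * c \<Longrightarrow> c * s = s * c"
proof -
  define y where "y = rec_nat (0::'a) (\<lambda>_ z. (1/2) *\<^sub>R (q + z * z))"
  define v where "v = rec_nat (0::real) (\<lambda>_ t. (1 + t * t) / 2)"
  have y0: "y 0 = 0" and yS: "y (Suc n) = (1/2) *\<^sub>R (q + y n * y n)" for n by (simp_all add: y_def)
  have v0: "v 0 = 0" and vS: "v (Suc n) = (1 + v n * v n) / 2" for n by (simp_all add: v_def)
  have v_ge: "0 \<le> v n" for n by (induction n) (simp_all add: v0 vS)
  have v_le: "v n \<le> 1" for n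
  proof (induction n)
    case (Suc n) then show ?case using v_ge[of n] mult_le_one[of "v n" "v n"] by (simp add: vS)
  qed (simp add: v0)
  have v_inc: "v n \<le> v (Suc n)" for n
    using sum_squares_ge_zero[of "1 - v n" 0] by (simp add: vS algebra_simps)
  have comm: "c * y n = y n * c" if "c * q = q * c" for c n
  proof (induction n)
    case (Suc n)
    have "c * (y n * y n) = (y n * y n) * c" by (metis Suc mult.assoc)
    then show ?case using that by (simp add: yS distrib_left distrib_right)
  qed (simp add: y0)
  have yq: "q * y n = y n * q" for n by (rule comm) simp
  have yy: "y m * y n = y n * y m" for m n by (rule comm) (simp add: yq)
  have y_sa: "star (y n) = y n" for n
    by (induction n) (simp_all add: y0 yS star_scaleR star_add star_mult sa)
  have ny: "norm (y n) \<le> v n" for n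
  proof (induction n)
    case (Suc n)
    have "norm (q + y n * y n) \<le> norm q + norm (y n * y n)" by (rule norm_triangle_ineq)
    moreover have "norm (y n * y n) \<le> v n * v n"
      using norm_mult_ineq[of "y n" "y n"] mult_mono[OF Suc Suc] v_ge by (meson norm_ge_zero order_trans)
    ultimately show ?case using nq by (simp add: yS vS)
  qed (simp add: y0 v0)
  have step: "norm (y (Suc n) - y n) \<le> v (Suc n) - v n" for n
  proof (induction n)
    case 0 then show ?case using nq by (simp add: y0 yS v0 vS)
  next
    case (Suc n)
    \<comment> \<open>The iterates commute, so a difference of squares factors; \<open>v\<close>
      obeys the same identity, which closes the induction.\<close>
    have "y (Suc (Suc n)) - y (Suc n) = (1/2) *\<^sub>R (y (Suc n) * y (Suc n) - y n * y n)"
      by (simp only: yS[of "Suc n"] yS[of n, THEN arg_cong[where f="\<lambda>z. _ - z"]])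
         (simp add: scaleR_diff_right[symmetric] del: scaleR_diff_right)
    also have "y (Suc n) * y (Suc n) - y n * y n = (y (Suc n) + y n) * (y (Suc n) - y n)"
      by (simp add: algebra_simps yy)
    finally have "norm (y (Suc (Suc n)) - y (Suc n)) = norm ((y (Suc n) + y n) * (y (Suc n) - y n)) / 2"
      by simp
    also have "norm ((y (Suc n) + y n) * (y (Suc n) - y n)) \<le> (v (Suc n) + v n) * (v (Suc n) - v n)"
    proof -
      have "norm (y (Suc n) + y n) \<le> v (Suc n) + v n"
        using norm_triangle_ineq[of "y (Suc n)" "y n"] ny[of n] ny[of "Suc n"] by simp
      then show ?thesis using mult_mono[OF _ Suc, of "norm (y (Suc n) + y n)"] norm_mult_ineq v_ge
        by (smt (verit) norm_ge_zero)
    qed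
    also have "\<dots> / 2 = v (Suc (Suc n)) - v (Suc n)"
      by (simp add: vS[of "Suc n"] vS[of n, THEN arg_cong[where f="\<lambda>z. _ - z"]]) (simp add: vS field_simps)
    finally show ?case by simp
  qed
  have diff: "norm (y (n + k) - y n) \<le> v (n + k) - v n" for n k
  proof (induction k)
    case (Suc k)
    then show ?case using step[of "n + k"] norm_triangle_ineq[of "y (Suc (n+k)) - y (n+k)" "y (n+k) - y n"] by simp
  qed simp
  have "incseq v" using v_inc by (rule incseq_SucI)
  then have "Cauchy v" using v_le by (meson incseq_convergent LIMSEQ_imp_Cauchy)
  have "Cauchy y"
    unfolding Cauchy_altdef2
  proof (intro allI impI)
    fix e :: real assume "e > 0"
    then obtain N where N: "\<And>n. n \<ge> N \<Longrightarrow> dist (v n) (v N) < e"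
      using \<open>Cauchy v\<close> unfolding Cauchy_altdef2 by blast
    have "dist (y n) (y N) < e" if "n \<ge> N" for n
      using diff[of N "n - N"] N[OF that] that by (simp add: dist_norm)
    then show "\<exists>N. \<forall>n\<ge>N. dist (y n) (y N) < e" by blast
  qed
  then obtain l where l: "y \<longlonglongrightarrow> l" by (auto simp: Cauchy_convergent_iff convergent_def)
  have bm: "bounded_linear (star :: 'a \<Rightarrow> 'a)"
    by (rule bounded_linear_intro[of _ 1]) (simp_all add: star_add star_scaleR norm_star)
  have "(\<lambda>n. y (Suc n)) \<longlonglongrightarrow> (1/2) *\<^sub>R (q + l * l)"
    unfolding yS by (intro tendsto_intros l)
  then have fx: "(1/2) *\<^sub>R (q + l * l) = l"
    using LIMSEQ_unique LIMSEQ_Suc[OF l] by blast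
  have "2 *\<^sub>R l = 2 *\<^sub>R (1/2) *\<^sub>R (q + l * l)" by (simp only: fx)
  then have ll: "q + l * l = 2 *\<^sub>R l" by (simp only: scaleR_scaleR) simp
  show ?thesis
  proof
    have "star l = l" using bounded_linear.tendsto[OF bm l] l by (simp add: y_sa LIMSEQ_unique)
    then show "star (1 - l) = 1 - l" by (simp add: star_diff)
    show "(1 - l) * (1 - l) = 1 - q" using ll by (simp add: algebra_simps scaleR_2)
    have "norm (y n) \<le> 1" for n using ny[of n] v_le[of n] by simp
    then show "norm (1 - (1 - l)) \<le> 1" using tendsto_norm[OF l] by (simp add: LIMSEQ_le_const2)
    fix c assume "c * q = q * c"
    then have "(\<lambda>n. c * y n) \<longlonglongrightarrow> l * c" by (simp add: comm tendsto_mult_right l)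
    moreover have "(\<lambda>n. c * y n) \<longlonglongrightarrow> c * l" by (intro tendsto_intros l)
    ultimately have "c * l = l * c" using LIMSEQ_unique by blast
    then show "c * (1 - l) = (1 - l) * c" by (simp add: algebra_simps)
  qed
qed

text \<open>With \<open>s = \<surd>(1 - c\<^sup>2)\<close> the element \<open>c + i s\<close> is unitary and \<open>s\<close> is its imaginary part.\<close>

lemma norm_one_minus_square:
  fixes c :: "'a::unital_cstar_algebra"
  assumes sa: "star c = c" and nc: "norm c \<le> 1"
  shows "norm (1 - c * c) \<le> 1"
proof -
  have "norm (c * c) \<le> 1" using nc by (simp add: norm_selfadjoint_square[OF sa] power_le_one)
  then obtain s where s: "star s = s" "s * s = 1 - c * c" and cs: "c * s = s * c"
    using sqrt_one_minus[of "c * c"] by (metis mult.assoc sa star_mult)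
  define u where "u = c + \<i> *\<^sub>C s"
  have su: "star u = c - \<i> *\<^sub>C s"
    by (simp add: u_def star_add star_scaleC sa s scaleC_minus_left)
  have "star u * u = c * c + s * s"
    by (simp add: su) (simp add: u_def algebra_simps mult_scaleC_left mult_scaleC_right cs scaleC_scaleC
        scaleC_minus_left scaleC_add_right scaleC_diff_right)
  then have "(norm u)\<^sup>2 \<le> 1" using cstar_identity[of u] s norm_one_le[where 'a='a] by simp
  then have nu: "norm u \<le> 1" by (simp add: power2_le_iff_abs_le abs_square_le_1)
  have "u - star u = 2 *\<^sub>R \<i> *\<^sub>C s" by (simp add: su) (simp add: u_def scaleR_2)
  then have "2 * norm s = norm (u - star u)" by (simp add: norm_scaleC)
  also have "\<dots> \<le> norm u + norm (star u)" by (rule norm_triangle_ineq4)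
  finally have "norm s \<le> 1" using nu by (simp add: norm_star)
  then show ?thesis using norm_selfadjoint_square[OF s(1)] s(2) by (simp add: power_le_one)
qed

section \<open>Positive elements and their norm characterization\<close>

text \<open>Self-adjoint squares are more accessible than the form \<open>star b * b\<close>; that
  the latter are also of this kind in unital algebras is Kaplansky's theorem.\<close>

definition psd :: "'a::cstar_algebra \<Rightarrow> bool"
  where "psd a \<longleftrightarrow> (\<exists>s. star s = s \<and> a = s * s)"

lemma psd_selfadjoint: "psd a \<Longrightarrow> star a = a"
  by (auto simp: psd_def star_mult)

lemma psd_square: "star s = s \<Longrightarrow> psd (s * s)"
  by (auto simp: psd_def)

text \<open>Scaling by \<open>1 / sqrt R\<close> turns \<open>a\<close> into the square of a
  self-adjoint contraction, to which \<open>norm_one_minus_square\<close> applies.\<close>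

lemma psd_norm_le:
  fixes a :: "'a::unital_cstar_algebra"
  assumes "psd a" and "norm a \<le> R"
  shows "norm (R *\<^sub>R 1 - a) \<le> R"
proof (cases "R = 0")
  case False
  then have R: "R > 0" using assms(2) norm_ge_zero[of a] by linarith
  obtain s where s: "star s = s" "a = s * s" using assms(1) by (auto simp: psd_def)
  define c where "c = (1 / sqrt R) *\<^sub>R s"
  have cc: "a = R *\<^sub>R (c * c)" using R by (simp add: c_def s)
  have "(norm c)\<^sup>2 \<le> 1"
    using assms(2) R norm_selfadjoint_square[OF s(1)] s(2) by (simp add: c_def power_divide)
  then have "norm c \<le> 1" by (simp add: abs_square_le_1)
  then have "norm (1 - c * c) \<le> 1" by (intro norm_one_minus_square) (simp add: c_def star_scaleR s)
  then have "R * norm (1 - c * c) \<le> R" using R by simp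
  moreover have "R *\<^sub>R 1 - a = R *\<^sub>R (1 - c * c)" by (simp add: cc scaleR_diff_right)
  ultimately show ?thesis using R by simp
qed (use assms in simp)

text \<open>For \<open>R > 0\<close> the element \<open>1 - a / R\<close> is a self-adjoint
  contraction, so the iteration applies to it. The estimate for \<open>s\<close> makes the root
  itself positive.\<close>

lemma sqrt_of_norm_le:
  fixes a :: "'a::unital_cstar_algebra"
  assumes sa: "star a = a" and le: "norm (R *\<^sub>R 1 - a) \<le> R"
  obtains s where "star s = s" "s * s = a" "norm (sqrt R *\<^sub>R 1 - s) \<le> sqrt R"
    "\<And>c. c * a = a * c \<Longrightarrow> c * s = s * c"
proof (cases "R = 0")
  case True
  then show ?thesis using le that[of 0] by simp
next
  case False
  then have R: "R > 0" using le norm_ge_zero[of "R *\<^sub>R 1 - a"] by linarith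
  define q where "q = 1 - (1 / R) *\<^sub>R a"
  have "q = (1 / R) *\<^sub>R (R *\<^sub>R 1 - a)" using R by (simp add: q_def scaleR_diff_right)
  then have "norm q \<le> 1" using le R by simp
  moreover have "star q = q" by (simp add: q_def star_diff star_scaleR sa)
  ultimately obtain s where s: "star s = s" "s * s = 1 - q" "norm (1 - s) \<le> 1"
    and sc: "\<And>c. c * q = q * c \<Longrightarrow> c * s = s * c" using sqrt_one_minus by blast
  show ?thesis
  proof (rule that[of "sqrt R *\<^sub>R s"])
    show "star (sqrt R *\<^sub>R s) = sqrt R *\<^sub>R s" by (simp add: star_scaleR s)
    show "sqrt R *\<^sub>R s * sqrt R *\<^sub>R s = a" using R by (simp add: s q_def)
    have "sqrt R *\<^sub>R 1 - sqrt R *\<^sub>R s = sqrt R *\<^sub>R (1 - s)" by (simp add: scaleR_diff_right)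
    then show "norm (sqrt R *\<^sub>R 1 - sqrt R *\<^sub>R s) \<le> sqrt R" using R s(3) by simp
    fix c assume "c * a = a * c"
    then have "c * s = s * c" by (intro sc) (simp add: q_def algebra_simps)
    then show "c * sqrt R *\<^sub>R s = sqrt R *\<^sub>R s * c" by simp
  qed
qed

lemma psd_of_norm_le:
  fixes a :: "'a::unital_cstar_algebra"
  shows "star a = a \<Longrightarrow> norm (R *\<^sub>R 1 - a) \<le> R \<Longrightarrow> psd a"
  by (metis psd_def sqrt_of_norm_le)

lemma psd_sqrt:
  fixes a :: "'a::unital_cstar_algebra"
  assumes "psd a"
  obtains s where "psd s" "s * s = a" "\<And>c. c * a = a * c \<Longrightarrow> c * s = s * c"
  using sqrt_of_norm_le[OF psd_selfadjoint[OF assms] psd_norm_le[OF assms order_refl]] psd_of_norm_le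
  by metis

text \<open>The norm criterion for positivity survives addition by the triangle inequality.\<close>

lemma psd_add:
  fixes a b :: "'a::unital_cstar_algebra"
  assumes "psd a" "psd b" shows "psd (a + b)"
proof (rule psd_of_norm_le)
  show "star (a + b) = a + b" using assms by (simp add: psd_selfadjoint star_add)
  have "norm ((norm a *\<^sub>R 1 - a) + (norm b *\<^sub>R 1 - b)) \<le> norm a + norm b"
    using psd_norm_le[OF assms(1) order_refl] psd_norm_le[OF assms(2) order_refl]
    by (rule norm_triangle_mono)
  then show "norm ((norm a + norm b) *\<^sub>R 1 - (a + b)) \<le> norm a + norm b"
    by (simp add: algebra_simps)
qed

lemma psd_scaleR:
  assumes "psd a" "r \<ge> 0" shows "psd (r *\<^sub>R a)"
proof -
  obtain s where "star s = s" "a = s * s" using assms by (auto simp: psd_def)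
  then have "star (sqrt r *\<^sub>R s) = sqrt r *\<^sub>R s" "r *\<^sub>R a = sqrt r *\<^sub>R s * sqrt r *\<^sub>R s"
    using assms(2) by (simp_all add: star_scaleR)
  then show ?thesis unfolding psd_def by blast
qed

text \<open>If \<open>a = t\<^sup>2 = - w\<^sup>2\<close> with commuting \<open>t\<close>, \<open>w\<close>, then \<open>t + i w\<close> has the vanishing square modulus \<open>t\<^sup>2 + w\<^sup>2\<close>.\<close>

lemma psd_antisym:
  fixes a :: "'a::unital_cstar_algebra"
  assumes "psd a" "psd (- a)" shows "a = 0"
proof -
  obtain t where t: "psd t" "t * t = a" and tc: "\<And>c. c * a = a * c \<Longrightarrow> c * t = t * c"
    by (rule psd_sqrt[OF assms(1)]) blast
  obtain w where w: "psd w" "w * w = - a" and wc: "\<And>c. c * - a = - a * c \<Longrightarrow> c * w = w * c"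
    using psd_sqrt[OF assms(2)] by metis
  have "t * a = a * t" by (simp add: t(2)[symmetric] mult.assoc)
  then have tw: "t * w = w * t" by (intro wc) simp
  define u where "u = t + \<i> *\<^sub>C w"
  have su: "star u = t - \<i> *\<^sub>C w"
    by (simp add: u_def star_add star_scaleC psd_selfadjoint t(1) w(1) scaleC_minus_left)
  have "star u * u = t * t + w * w"
    by (simp add: su) (simp add: u_def algebra_simps mult_scaleC_left mult_scaleC_right tw scaleC_scaleC
        scaleC_minus_left scaleC_add_right scaleC_diff_right)
  then have "u = 0" using cstar_identity[of u] by (simp add: t w)
  moreover have "u + star u = 2 *\<^sub>R t" by (simp add: su) (simp add: u_def scaleR_2)
  ultimately have "2 *\<^sub>R t = 0" by simp
  then show ?thesis using t(2) by simp
qed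

section \<open>Positivity of \<open>star x * x\<close>\<close>

lemma le_one_of_power_le:
  fixes z :: real
  assumes "z \<ge> 0" and le: "\<And>m. z ^ 2 ^ m \<le> real (2 ^ m) + 1"
  shows "z \<le> 1"
proof (rule ccontr)
  assume "\<not> z \<le> 1"
  then have z: "1 < z" by simp
  then have "(\<lambda>n. real n * (1/z) ^ n) \<longlonglongrightarrow> 0" by (intro powser_times_n_limit_0) simp
  then have "eventually (\<lambda>n. real n * (1/z) ^ n < 1/2) sequentially"
    by (rule order_tendstoD) simp
  then obtain N where N: "\<And>n. n \<ge> N \<Longrightarrow> real n * (1/z) ^ n < 1/2" by (auto simp: eventually_sequentially)
  have "N \<le> 2 ^ N" using less_exp[of N] by simp
  from N[OF this] have "real (2 ^ N) < z ^ 2 ^ N / 2" using z by (simp add: field_simps power_divide)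
  moreover have "real (2 ^ N) \<ge> 1" by simp
  ultimately show False using le[of N] by linarith
qed

text \<open>The elements \<open>P\<close> and \<open>Y\<close> are intertwined by
  \<open>star x\<close>, so \<open>Y ^ n\<close> grows at most like \<open>(n + 1) * R ^ n\<close>;
  for the self-adjoint \<open>Y\<close> this forces \<open>norm Y \<le> R\<close>.\<close>

lemma psd_flip:
  fixes x :: "'a::unital_cstar_algebra"
  assumes p: "psd (x * star x)"
  shows "psd (star x * x)"
proof -
  define R where "R = (norm x)\<^sup>2"
  define P where "P = R *\<^sub>R 1 - x * star x"
  define Y where "Y = R *\<^sub>R 1 - star x * x"
  have R0: "R \<ge> 0" by (simp add: R_def)
  have nP: "norm P \<le> R" unfolding P_def by (rule psd_norm_le[OF p]) (simp add: R_def cstar_identity')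
  have Ysa: "star Y = Y" by (simp add: Y_def star_diff star_scaleR star_mult star_star)
  have "star x * P = Y * star x" by (simp add: P_def Y_def algebra_simps)
  then have c: "star x * P ^ n = Y ^ n * star x" for n by (rule power_commute_left)
  have bound: "norm (Y ^ n * (star x * x)) \<le> R * R ^ n" for n
  proof -
    have "norm (Y ^ n * (star x * x)) = norm (star x * P ^ n * x)" by (simp add: c mult.assoc)
    also have "\<dots> \<le> norm (star x) * norm (P ^ n) * norm x"
      by (meson mult_right_mono norm_ge_zero norm_mult_ineq order_trans)
    also have "\<dots> = R * norm (P ^ n)" by (simp add: R_def norm_star power2_eq_square)
    also have "norm (P ^ n) \<le> R ^ n"
      using norm_power_le[of P n] power_mono[OF nP norm_ge_zero] by (meson order_trans)
    finally show ?thesis using R0 by (simp add: mult_left_mono)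
  qed
  have grow: "norm (Y ^ n) \<le> (real n + 1) * R ^ n" for n
  proof (induction n)
    case (Suc n)
    have "Y ^ Suc n = R *\<^sub>R Y ^ n - Y ^ n * (star x * x)"
      by (simp only: power_Suc2) (simp add: Y_def right_diff_distrib)
    then have "norm (Y ^ Suc n) \<le> R * norm (Y ^ n) + R * R ^ n"
      using norm_triangle_ineq4[of "R *\<^sub>R Y ^ n" "Y ^ n * (star x * x)"] bound[of n] R0 by simp
    also have "\<dots> \<le> R * ((real n + 1) * R ^ n) + R * R ^ n"
      using Suc R0 by (simp add: mult_left_mono)
    finally show ?case by (simp add: algebra_simps)
  qed (simp add: norm_one_le)
  have "norm Y \<le> R"
  proof (cases "R = 0")
    case True then show ?thesis using grow[of 1] by simp
  next
    case False
    have "norm Y / R \<le> 1"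
    proof (rule le_one_of_power_le)
      fix m
      have "norm Y ^ 2 ^ m \<le> (real (2 ^ m) + 1) * R ^ 2 ^ m"
        using grow[of "2 ^ m"] norm_selfadjoint_power[OF Ysa] by simp
      then show "(norm Y / R) ^ 2 ^ m \<le> real (2 ^ m) + 1"
        using False R0 by (simp add: power_divide divide_le_eq)
    qed (use R0 in simp)
    then show ?thesis using False R0 by (simp add: divide_le_eq)
  qed
  then show ?thesis by (intro psd_of_norm_le[of _ R]) (simp_all add: Y_def star_mult star_star)
qed

text \<open>Up to sign, \<open>a\<close> and \<open>b\<close> are twice the real and imaginary parts
  of \<open>v\<close>, and \<open>a * a + b * b\<close> is twice
  \<open>v * star v + star v * v\<close>. Hence \<open>v * star v\<close> is a sum of squares, and
  exchanging its factors makes \<open>- (w * w)\<close> positive.\<close>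

lemma star_mult_self_eq_minus_square:
  fixes v w :: "'a::unital_cstar_algebra"
  assumes w: "star w = w" and eq: "star v * v = - (w * w)"
  shows "w = 0"
proof -
  define a where "a = v + star v"
  define b where "b = \<i> *\<^sub>C (v - star v)"
  have sa: "star a = a" "star b = b"
    by (simp_all add: a_def b_def star_add star_scaleC star_diff star_star add.commute
        scaleC_minus_left scaleC_diff_right)
  have "a * a + b * b = 2 *\<^sub>R (v * star v + star v * v)"
    by (simp add: a_def b_def mult_scaleC_left mult_scaleC_right scaleC_scaleC scaleC_minus_left
        algebra_simps scaleR_2 scaleC_diff_right)
  then have "v * star v = (1/2) *\<^sub>R (a * a + b * b) + w * w" by (simp add: eq)
  then have "psd (v * star v)" using w sa by (simp add: psd_add psd_scaleR psd_square del: scaleR_add_right)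
  then have "psd (- (w * w))" using psd_flip eq by metis
  then have "w * w = 0" using psd_antisym psd_square w by blast
  then show ?thesis using norm_selfadjoint_square[OF w] by simp
qed

text \<open>Kaplansky's theorem: with \<open>c = \<bar>h\<bar> - h\<close>, twice the negative part of \<open>h = x\<^sup>*x\<close>, the element
  \<open>(x c)\<^sup>*(x c) = - \<bar>h\<bar> c\<^sup>2\<close> is the negative of a square, hence zero.\<close>

lemma psd_star_mult_self:
  fixes x :: "'a::unital_cstar_algebra"
  shows "psd (star x * x)"
proof -
  define h where "h = star x * x"
  have h: "star h = h" by (simp add: h_def star_mult star_star)
  obtain m where m: "psd m" "m * m = h * h" and mc: "\<And>c. c * (h * h) = h * h * c \<Longrightarrow> c * m = m * c"
    by (rule psd_sqrt[OF psd_square[OF h]]) blast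
  have hm: "h * m = m * h" by (intro mc) (simp add: mult.assoc)
  obtain t where t: "psd t" "t * t = m" and tc: "\<And>c. c * m = m * c \<Longrightarrow> c * t = t * c"
    by (rule psd_sqrt[OF m(1)]) blast
  define c where "c = m - h"
  have c: "star c = c" using m(1) h by (simp add: c_def star_diff psd_selfadjoint)
  have ct: "c * t = t * c" by (intro tc) (simp add: c_def algebra_simps hm)
  have hc: "h * c = - (m * c)" by (simp add: c_def algebra_simps m hm)
  have mcc: "m * c = c * m" by (simp add: c_def algebra_simps hm)
  define w where "w = t * c"
  have w: "star w = w" using t(1) c ct by (simp add: w_def star_mult psd_selfadjoint)
  have ww: "w * w = m * c * c" by (metis w_def ct t(2) mult.assoc)
  have "star (x * c) * (x * c) = c * (h * c)" by (simp add: star_mult c h_def mult.assoc)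
  also have "\<dots> = - (w * w)" by (simp add: hc ww mcc mult.assoc)
  finally have "w = 0" using star_mult_self_eq_minus_square w by blast
  then have "m * c * c = 0" using ww by simp
  moreover have "c * c = 2 *\<^sub>R (m * c)"
  proof -
    have "c * c = m * c - h * c" by (simp only: c_def left_diff_distrib)
    then show ?thesis by (simp add: hc scaleR_2)
  qed
  \<comment> \<open>The cube of \<open>c\<close> vanishes, and a self-adjoint nilpotent element is
    zero by the C*-identity.\<close>
  ultimately have "(c * c) * c = 0" by simp
  then have "norm ((c * c) * (c * c)) = 0" by (simp add: mult.assoc[symmetric])
  then have "c = 0" using norm_selfadjoint_square[of "c * c"] norm_selfadjoint_square[OF c]
    by (simp add: star_mult c)
  then show ?thesis using m(1) by (simp add: c_def h_def)
qed

section \<open>Inverses and order comparison\<close>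

lemma psd_conjugate:
  fixes t :: "'a::unital_cstar_algebra"
  assumes "psd a" shows "psd (t * a * star t)"
proof -
  obtain s where s: "star s = s" "a = s * s" using assms by (auto simp: psd_def)
  then show ?thesis using psd_star_mult_self[of "s * star t"] by (simp add: star_mult star_star mult.assoc)
qed

text \<open>With \<open>R = norm a\<close>, the element \<open>a + e\<close> is \<open>R + e\<close>
  times \<open>1 - q\<close> where \<open>norm q < 1\<close>; the inverse of \<open>1 - q\<close> is
  the fixed point of the contraction \<open>b \<mapsto> 1 + q * b\<close>.\<close>

lemma psd_add_scaleR_inverse:
  fixes a :: "'a::unital_cstar_algebra"
  assumes a: "psd a" and e: "e > 0"
  obtains v where "(a + e *\<^sub>R 1) * v = 1" "v * (a + e *\<^sub>R 1) = 1" "star v = v" "norm v \<le> 1 / e"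
    "\<And>c. c * a = a * c \<Longrightarrow> c * v = v * c"
proof -
  define R where "R = norm a"
  define q where "q = (1 / (R + e)) *\<^sub>R (R *\<^sub>R 1 - a)"
  have Re: "R + e > 0" "R \<ge> 0" using e by (simp_all add: R_def add_nonneg_pos)
  have nq: "norm q \<le> R / (R + e)"
    using psd_norm_le[OF a order_refl] Re by (simp add: q_def R_def divide_right_mono)
  have lt: "R / (R + e) < 1" using e Re by simp
  have aq: "a + e *\<^sub>R 1 = (R + e) *\<^sub>R (1 - q)"
    using Re by (simp add: q_def scaleR_diff_right scaleR_add_left)
  have fix1: "\<exists>b. 1 + q * b = b"
  proof -
    have "\<exists>!x. 1 + q * x = x"
    proof (rule banach_fix_type[of "R / (R + e)"], safe)
      fix b c
      have "dist (1 + q * b) (1 + q * c) = norm (q * (b - c))" by (simp add: dist_norm algebra_simps)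
      also have "\<dots> \<le> norm q * norm (b - c)" by (rule norm_mult_ineq)
      also have "\<dots> \<le> R / (R + e) * norm (b - c)" using nq by (rule mult_right_mono) simp
      finally show "dist (1 + q * b) (1 + q * c) \<le> R / (R + e) * dist b c" by (simp add: dist_norm)
    qed (use Re lt in auto)
    then show ?thesis by blast
  qed
  then obtain b where b: "1 + q * b = b" by blast
  have qsa: "star q = q" by (simp add: q_def star_scaleR star_diff psd_selfadjoint a)
  have b': "1 + star b * q = star b" using arg_cong[OF b, of star] by (simp add: star_add star_mult qsa)
  have r: "(1 - q) * b = 1" using b by (simp add: algebra_simps)
  have l: "star b * (1 - q) = 1" using b' by (simp add: algebra_simps)
  have bsa: "star b = b" by (metis l r mult.assoc mult_1_left mult_1_right)
  define v where "v = (1 / (R + e)) *\<^sub>R b"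
  have v1: "(a + e *\<^sub>R 1) * v = 1" using r Re by (simp add: aq v_def)
  have v2: "v * (a + e *\<^sub>R 1) = 1" using l bsa Re by (simp add: aq v_def)
  show ?thesis
  proof (rule that[OF v1 v2])
    show "star v = v" by (simp add: v_def star_scaleR bsa)
    \<comment> \<open>Since \<open>norm (R - a) \<le> R\<close>, this identity leaves
      \<open>e * norm v \<le> 1\<close>.\<close>
    have "(R + e) *\<^sub>R v - (R *\<^sub>R 1 - a) * v = 1" using v1 by (simp add: algebra_simps)
    moreover have "norm ((R *\<^sub>R 1 - a) * v) \<le> R * norm v"
      using norm_mult_ineq[of "R *\<^sub>R 1 - a" v] psd_norm_le[OF a order_refl]
      by (simp add: R_def) (meson mult_right_mono norm_ge_zero order_trans)
    ultimately have "(R + e) * norm v - R * norm v \<le> 1"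
      using norm_triangle_ineq2[of "(R + e) *\<^sub>R v" "(R *\<^sub>R 1 - a) * v"] norm_one_le[where 'a='a] Re by simp
    then show "norm v \<le> 1 / e" using e by (simp add: algebra_simps field_simps)
    fix c assume c: "c * a = a * c"
    have "v * (c * (a + e *\<^sub>R 1)) * v = v * ((a + e *\<^sub>R 1) * c) * v" by (simp add: algebra_simps c)
    then show "c * v = v * c" by (metis v1 v2 mult.assoc mult_1_left mult_1_right)
  qed
qed

text \<open>Paschke's argument: \<open>\<parallel>R k R\<parallel> \<le> 1\<close> for \<open>R = (h + e)\<^sup>-\<^sup>1\<^sup>/\<^sup>2\<close> means \<open>k \<le> h + e\<close>.\<close>

lemma psd_diff_of_norm_le:
  fixes h k :: "'a::unital_cstar_algebra"
  assumes h: "psd h" and k: "star k = k"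
    and le: "\<And>e s R. e > 0 \<Longrightarrow> psd s \<Longrightarrow> s * s = h + e *\<^sub>R 1 \<Longrightarrow> (\<And>c. c * h = h * c \<Longrightarrow> c * s = s * c) \<Longrightarrow>
      star R = R \<Longrightarrow> R * s = 1 \<Longrightarrow> s * R = 1 \<Longrightarrow> norm (R * k * R) \<le> norm (R * h * R)"
  shows "psd (h - k)"
proof -
  have pe: "psd (h + e *\<^sub>R 1 - k)" if e: "e > 0" for e
  proof -
    have "psd (e *\<^sub>R (1::'a))" using psd_square[of "1::'a"] e by (intro psd_scaleR) simp_all
    then have "psd (h + e *\<^sub>R 1)" by (intro psd_add h)
    then obtain s where s: "psd s" "s * s = h + e *\<^sub>R 1"
      and sc: "\<And>c. c * (h + e *\<^sub>R 1) = (h + e *\<^sub>R 1) * c \<Longrightarrow> c * s = s * c" using psd_sqrt by blast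
    have sc': "c * s = s * c" if "c * h = h * c" for c by (rule sc) (simp add: algebra_simps that)
    obtain v where v: "(h + e *\<^sub>R 1) * v = 1" "v * (h + e *\<^sub>R 1) = 1" "star v = v" "norm v \<le> 1 / e"
      and vc: "\<And>c. c * h = h * c \<Longrightarrow> c * v = v * c" by (rule psd_add_scaleR_inverse[OF h e]) blast
    have "s * h = h * s" using sc'[of h] by simp
    then have sv: "s * v = v * s" by (rule vc)
    define R where "R = s * v"
    have R: "star R = R" by (simp add: R_def star_mult v(3) psd_selfadjoint s(1) sv)
    have sR: "s * R = 1" by (simp add: R_def mult.assoc[symmetric] s(2) v(1))
    have Rs: "R * s = 1" by (simp add: R_def sv mult.assoc s(2) v(2))
    \<comment> \<open>Conjugating \<open>h + e\<close> by its inverse root \<open>R\<close> gives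
      \<open>1\<close>, and \<open>R * R = v\<close>.\<close>
    have "R * h * R = 1 - e *\<^sub>R v"
    proof -
      have "R * (s * s) * R = 1" by (metis Rs sR mult.assoc mult_1_left)
      then have "R * h * R = 1 - e *\<^sub>R (R * R)" by (simp add: s(2) algebra_simps eq_diff_eq)
      moreover have "R * R = v"
        by (metis R_def sR sv mult.assoc mult_1_left mult_1_right)
      ultimately show ?thesis by simp
    qed
    moreover have "norm (1 *\<^sub>R 1 - e *\<^sub>R v) \<le> 1"
    proof (rule psd_norm_le)
      have "v = v * s * star (v * s)"
        by (metis R R_def sR sv mult.assoc mult_1_left mult_1_right)
      then have "psd v" using psd_star_mult_self[of "star (v * s)"] by (simp add: star_star)
      then show "psd (e *\<^sub>R v)" using e by (simp add: psd_scaleR)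
      show "norm (e *\<^sub>R v) \<le> 1" using v(4) e by (simp add: field_simps)
    qed
    ultimately have "norm (R * k * R) \<le> 1" using le[OF e s sc' R Rs sR] by simp
    then have "psd (1 - R * k * R)"
      by (intro psd_of_norm_le[of _ 1]) (simp_all add: star_diff star_mult R k mult.assoc)
    then have "psd (s * (1 - R * k * R) * star s)" by (rule psd_conjugate)
    moreover have "s * (1 - R * k * R) * star s = h + e *\<^sub>R 1 - k"
    proof -
      have "s * (R * k * R) * s = k" by (metis Rs sR mult.assoc mult_1_left mult_1_right)
      then show ?thesis by (simp add: psd_selfadjoint s(1) right_diff_distrib left_diff_distrib s(2))
    qed
    ultimately show ?thesis by simp
  qed
  \<comment> \<open>A bound valid for all shifts \<open>d \<le> 1\<close> at once, so that the norm
    criterion passes to the limit as \<open>d\<close> tends to \<open>0\<close>.\<close>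
  define B where "B = norm (h - k) + 1"
  have "norm (B *\<^sub>R 1 - (h - k)) \<le> B"
  proof (rule field_le_epsilon)
    fix e :: real assume "e > 0"
    define d where "d = min 1 e"
    have d: "d > 0" "d \<le> 1" "d \<le> e" using \<open>e > 0\<close> by (auto simp: d_def)
    have nd: "norm (d *\<^sub>R (1::'a)) \<le> d" using d(1) norm_one_le[where 'a='a] by simp
    have "norm (h + d *\<^sub>R 1 - k) \<le> B"
      using norm_triangle_mono[OF order_refl nd, of "h - k"] d by (simp add: B_def algebra_simps)
    then have "norm (B *\<^sub>R 1 - (h + d *\<^sub>R 1 - k)) \<le> B" using pe[OF d(1)] by (intro psd_norm_le)
    then have "norm (B *\<^sub>R 1 - (h + d *\<^sub>R 1 - k) + d *\<^sub>R 1) \<le> B + d" using nd by (rule norm_triangle_mono)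
    then show "norm (B *\<^sub>R 1 - (h - k)) \<le> B + e" using d by (simp add: algebra_simps)
  qed
  then show ?thesis by (intro psd_of_norm_le) (simp_all add: star_diff k psd_selfadjoint h)
qed

section \<open>Multiplier algebras\<close>

text \<open>Choose \<open>b = y - z\<close> and apply the C*-identity; this nondegeneracy does the
  work of a unit.\<close>

lemma eq_if_star_mult_eq:
  fixes y z :: "'a::cstar_algebra"
  assumes "\<And>b. star b * y = star b * z" shows "y = z"
  using assms[of "y - z"] cstar_identity[of "y - z"] by (simp add: right_diff_distrib)

lift_definition scaleC_blinfun :: "complex \<Rightarrow> ('a::real_normed_vector \<Rightarrow>\<^sub>L 'b::complex_banach) \<Rightarrow> 'a \<Rightarrow>\<^sub>L 'b"
  is "\<lambda>c f x. c *\<^sub>C f x"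
proof -
  fix c :: complex and f :: "'a \<Rightarrow> 'b" assume f: "bounded_linear f"
  have "bounded_linear (\<lambda>y::'b. c *\<^sub>C y)"
    by (rule bounded_linear_intro[of _ "norm c"])
       (simp_all add: scaleC_add_right scaleC_scaleR norm_scaleC mult.commute)
  then show "bounded_linear (\<lambda>x. c *\<^sub>C f x)" using f by (rule bounded_linear_compose)
qed

lemma norm_scaleC_blinfun: "norm (scaleC_blinfun c f) = norm c * norm f"
proof -
  have le: "norm (scaleC_blinfun c f) \<le> norm c * norm f" for c and f :: "'a \<Rightarrow>\<^sub>L 'b"
    by (rule norm_blinfun_bound)
       (simp_all add: scaleC_blinfun.rep_eq norm_scaleC norm_blinfun mult.assoc mult_left_mono)
  show ?thesis
  proof (cases "c = 0")
    case True
    then show ?thesis using le[of 0 f] by simp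
  next
    case False
    have "scaleC_blinfun (inverse c) (scaleC_blinfun c f) = f"
      using False by (intro blinfun_eqI) (simp add: scaleC_blinfun.rep_eq scaleC_scaleC)
    then have "norm f \<le> norm (inverse c) * norm (scaleC_blinfun c f)" by (metis le)
    then have "norm c * norm f \<le> norm (scaleC_blinfun c f)"
      using False by (simp add: norm_divide field_simps)
    then show ?thesis using le by (simp add: antisym)
  qed
qed

text \<open>The multiplier algebra: pairs of an operator on the algebra and its adjoint with respect to the
  inner product \<open>star a * b\<close>. It is unital even if the algebra is not.\<close>

typedef (overloaded) ('a::cstar_algebra) multiplier =
  "{p :: ('a \<Rightarrow>\<^sub>L 'a) \<times> ('a \<Rightarrow>\<^sub>L 'a). \<forall>a b. star (blinfun_apply (fst p) a) * b = star a * blinfun_apply (snd p) b}"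
  by (intro exI[of _ "(0, 0)"]) simp

lifting_forget blinfun.lifting
setup_lifting type_definition_multiplier

lift_definition mop :: "'a::cstar_algebra multiplier \<Rightarrow> 'a \<Rightarrow>\<^sub>L 'a" is fst .
lift_definition madj :: "'a::cstar_algebra multiplier \<Rightarrow> 'a \<Rightarrow>\<^sub>L 'a" is snd .

lemma star_mop_mult: "star (mop F a) * b = star a * madj F b"
  by transfer simp

lemma madj_unique:
  assumes "\<And>a b. star (mop F a) * b = star a * g b"
  shows "madj F b = g b"
  by (rule eq_if_star_mult_eq) (metis assms star_mop_mult)

text \<open>The operator determines its adjoint, so comparing first components suffices.\<close>

lemma multiplier_eqI:
  assumes "\<And>a. mop F a = mop G a" shows "F = G"
proof -
  have "mop F = mop G" using assms by (rule blinfun_eqI)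
  moreover have "madj F b = madj G b" for b
    by (rule madj_unique[where g="madj G"]) (metis assms star_mop_mult)
  then have "madj F = madj G" by (rule blinfun_eqI)
  ultimately show ?thesis
    by (simp add: mop.rep_eq madj.rep_eq prod_eq_iff Rep_multiplier_inject[symmetric])
qed

instantiation multiplier :: (cstar_algebra) real_normed_vector
begin

lift_definition zero_multiplier :: "'a multiplier" is "(0, 0)" by simp

lift_definition plus_multiplier :: "'a multiplier \<Rightarrow> 'a multiplier \<Rightarrow> 'a multiplier"
  is "\<lambda>p q. (fst p + fst q, snd p + snd q)"
  by (simp add: blinfun.bilinear_simps star_add algebra_simps)

lift_definition minus_multiplier :: "'a multiplier \<Rightarrow> 'a multiplier \<Rightarrow> 'a multiplier"
  is "\<lambda>p q. (fst p - fst q, snd p - snd q)"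
  by (simp add: blinfun.bilinear_simps star_diff algebra_simps)

lift_definition uminus_multiplier :: "'a multiplier \<Rightarrow> 'a multiplier"
  is "\<lambda>p. (- fst p, - snd p)"
  by (simp add: blinfun.bilinear_simps star_minus)

lift_definition scaleR_multiplier :: "real \<Rightarrow> 'a multiplier \<Rightarrow> 'a multiplier"
  is "\<lambda>r p. (r *\<^sub>R fst p, r *\<^sub>R snd p)"
  by (simp add: blinfun.bilinear_simps star_scaleR)

definition norm_multiplier :: "'a multiplier \<Rightarrow> real"
  where "norm_multiplier F = norm (mop F)"

definition dist_multiplier :: "'a multiplier \<Rightarrow> 'a multiplier \<Rightarrow> real"
  where "dist_multiplier F G = norm (F - G)"

definition sgn_multiplier :: "'a multiplier \<Rightarrow> 'a multiplier"
  where "sgn_multiplier F = inverse (norm F) *\<^sub>R F"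

definition uniformity_multiplier :: "('a multiplier \<times> 'a multiplier) filter"
  where "uniformity_multiplier = (INF e\<in>{0<..}. principal {(x, y). dist x y < e})"

definition open_multiplier :: "'a multiplier set \<Rightarrow> bool"
  where "open_multiplier S = (\<forall>x\<in>S. \<forall>\<^sub>F (x', y) in uniformity. x' = x \<longrightarrow> y \<in> S)"

lemma mop_simps [simp]:
  "mop 0 = (0::'a \<Rightarrow>\<^sub>L 'a)" "mop (F + G) = mop F + mop (G::'a multiplier)"
  "mop (F - G) = mop F - mop (G::'a multiplier)" "mop (- F) = - mop (F::'a multiplier)"
  "mop (r *\<^sub>R F) = r *\<^sub>R mop (F::'a multiplier)"
  by (transfer; simp)+

instance
proof
  fix F G H :: "'a multiplier" and r s :: real
  show "F + G + H = F + (G + H)" "F + G = G + F" "0 + F = F" "- F + F = 0" "F - G = F + - G"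
    "r *\<^sub>R (F + G) = r *\<^sub>R F + r *\<^sub>R G" "(r + s) *\<^sub>R F = r *\<^sub>R F + s *\<^sub>R F" "r *\<^sub>R s *\<^sub>R F = (r * s) *\<^sub>R F"
    "1 *\<^sub>R F = F"
    by (rule multiplier_eqI; simp add: blinfun.bilinear_simps add_ac scaleR_add_left scaleR_add_right)+
  show "norm F = 0 \<longleftrightarrow> F = 0"
  proof
    assume "norm F = 0"
    then have "mop F = 0" by (simp add: norm_multiplier_def)
    then show "F = 0" by (intro multiplier_eqI) simp
  qed (simp add: norm_multiplier_def)
  show "norm (F + G) \<le> norm F + norm G" by (simp add: norm_multiplier_def norm_triangle_ineq)
  show "norm (r *\<^sub>R F) = \<bar>r\<bar> * norm F" by (simp add: norm_multiplier_def)
qed (simp_all add: dist_multiplier_def sgn_multiplier_def uniformity_multiplier_def open_multiplier_def)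

end

lemma madj_simps [simp]:
  "madj 0 = 0" "madj (F + G) = madj F + madj G" "madj (F - G) = madj F - madj G"
  by (transfer; simp)+

text \<open>Each operator bounds the other through the C*-identity; hence Cauchy sequences of
  multipliers converge in both components.\<close>

lemma norm_madj: "norm (madj F) = norm F"
proof (rule antisym)
  show "norm (madj F) \<le> norm F"
  proof (rule norm_blinfun_bound)
    fix b
    let ?c = "madj F b"
    have "(norm ?c)\<^sup>2 = norm (star (mop F ?c) * b)" by (simp add: star_mop_mult cstar_identity)
    also have "\<dots> \<le> norm (mop F ?c) * norm b" by (metis norm_mult_ineq norm_star)
    also have "\<dots> \<le> (norm F * norm ?c) * norm b"
      by (simp add: norm_multiplier_def norm_blinfun mult_right_mono)
    finally have "norm ?c * norm ?c \<le> (norm F * norm b) * norm ?c" by (simp add: power2_eq_square mult_ac)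
    then show "norm ?c \<le> norm F * norm b" by (cases "?c = 0") simp_all
  qed simp
  show "norm F \<le> norm (madj F)"
    unfolding norm_multiplier_def
  proof (rule norm_blinfun_bound)
    fix b
    let ?c = "mop F b"
    have "(norm ?c)\<^sup>2 = norm (star b * madj F ?c)" by (simp add: star_mop_mult[symmetric] cstar_identity)
    also have "\<dots> \<le> norm b * norm (madj F ?c)" by (metis norm_mult_ineq norm_star)
    also have "\<dots> \<le> norm b * (norm (madj F) * norm ?c)" by (simp add: norm_blinfun mult_left_mono)
    finally have "norm ?c * norm ?c \<le> (norm (madj F) * norm b) * norm ?c" by (simp add: power2_eq_square mult_ac)
    then show "norm ?c \<le> norm (madj F) * norm b" by (cases "?c = 0") simp_all
  qed simp
qed

instance multiplier :: (cstar_algebra) banach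
proof
  fix X :: "nat \<Rightarrow> 'a multiplier" assume X: "Cauchy X"
  have "dist (mop (X m)) (mop (X n)) = dist (X m) (X n)"
    "dist (madj (X m)) (madj (X n)) = dist (X m) (X n)" for m n
    using norm_madj[of "X m - X n"] by (simp_all add: dist_norm norm_multiplier_def)
  then have "Cauchy (\<lambda>n. mop (X n))" "Cauchy (\<lambda>n. madj (X n))"
    using X by (simp_all add: Cauchy_def)
  then obtain f g where f: "(\<lambda>n. mop (X n)) \<longlonglongrightarrow> f" and g: "(\<lambda>n. madj (X n)) \<longlonglongrightarrow> g"
    by (auto simp: Cauchy_convergent_iff convergent_def)
  have bs: "bounded_linear (star :: 'a \<Rightarrow> 'a)"
    by (rule bounded_linear_intro[of _ 1]) (simp_all add: star_add star_scaleR norm_star)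
  have "star (f a) * b = star a * g b" for a b
  proof -
    have "(\<lambda>n. star (mop (X n) a) * b) \<longlonglongrightarrow> star (f a) * b"
      by (intro tendsto_intros bounded_linear.tendsto[OF bs] f)
    moreover have "(\<lambda>n. star a * madj (X n) b) \<longlonglongrightarrow> star a * g b"
      by (intro tendsto_intros g)
    ultimately show ?thesis by (simp add: star_mop_mult LIMSEQ_unique)
  qed
  then have "(f, g) \<in> {p. \<forall>a b. star (blinfun_apply (fst p) a) * b = star a * blinfun_apply (snd p) b}"
    by simp
  then have F: "mop (Abs_multiplier (f, g)) = f" by (simp add: mop.rep_eq Abs_multiplier_inverse)
  define F where "F = Abs_multiplier (f, g)"
  have "(\<lambda>n. norm (X n - F)) \<longlonglongrightarrow> 0"
    using f by (simp add: norm_multiplier_def F F_def LIM_zero tendsto_norm_zero)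
  then have "X \<longlonglongrightarrow> F" by (metis LIM_zero_cancel tendsto_norm_zero_cancel)
  then show "convergent X" by (auto simp: convergent_def)
qed

instantiation multiplier :: (cstar_algebra) unital_cstar_algebra
begin

lift_definition scaleC_multiplier :: "complex \<Rightarrow> 'a multiplier \<Rightarrow> 'a multiplier"
  is "\<lambda>c p. (scaleC_blinfun c (fst p), scaleC_blinfun (cnj c) (snd p))"
  by (simp add: scaleC_blinfun.rep_eq star_scaleC mult_scaleC_left mult_scaleC_right)

lift_definition times_multiplier :: "'a multiplier \<Rightarrow> 'a multiplier \<Rightarrow> 'a multiplier"
  is "\<lambda>p q. (fst p o\<^sub>L fst q, snd q o\<^sub>L snd p)"
  by simp

lift_definition one_multiplier :: "'a multiplier" is "(id_blinfun, id_blinfun)" by simp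

lift_definition star_multiplier :: "'a multiplier \<Rightarrow> 'a multiplier" is "\<lambda>p. (snd p, fst p)"
  by simp (metis star_mult star_star)

lemma mop_simps2 [simp]:
  "mop (c *\<^sub>C F) a = c *\<^sub>C mop (F::'a multiplier) a" "mop (F * G) a = mop F (mop (G::'a multiplier) a)"
  "mop 1 a = (a::'a)" "mop (star F) = madj (F::'a multiplier)" "madj (star F) = mop F"
  "madj (c *\<^sub>C F) a = cnj c *\<^sub>C madj (F::'a multiplier) a" "madj (F * G) a = madj G (madj (F::'a multiplier) a)"
  by (transfer; simp add: scaleC_blinfun.rep_eq)+

text \<open>Bounded linear functions are only real linear by type; the existence of an adjoint
  forces complex linearity.\<close>

lemma mop_scaleC_right: "mop F (c *\<^sub>C a) = c *\<^sub>C mop (F::'a multiplier) a"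
proof (rule eq_if_star_mult_eq)
  show "star d * mop F (c *\<^sub>C a) = star d * (c *\<^sub>C mop F a)" for d
    using star_mop_mult[of "star F" d "c *\<^sub>C a"] star_mop_mult[of "star F" d a]
    by (simp add: mult_scaleC_right)
qed

instance
proof
  fix F G H :: "'a multiplier" and c d :: complex and r :: real
  show "c *\<^sub>C (F + G) = c *\<^sub>C F + c *\<^sub>C G" "(c + d) *\<^sub>C F = c *\<^sub>C F + d *\<^sub>C F" "c *\<^sub>C d *\<^sub>C F = (c * d) *\<^sub>C F"
    "of_real r *\<^sub>C F = r *\<^sub>R F"
    "F * G * H = F * (G * H)" "(F + G) * H = F * H + G * H" "F * (G + H) = F * G + F * H"
    "r *\<^sub>R F * G = r *\<^sub>R (F * G)" "F * r *\<^sub>R G = r *\<^sub>R (F * G)" "1 * F = F" "F * 1 = F"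
    "(c *\<^sub>C F) * G = c *\<^sub>C (F * G)" "F * (c *\<^sub>C G) = c *\<^sub>C (F * G)"
    "star (F + G) = star F + star G" "star (c *\<^sub>C F) = cnj c *\<^sub>C star F" "star (F * G) = star G * star F"
    "star (star F) = F"
    by (rule multiplier_eqI; simp add: blinfun.bilinear_simps scaleC_add_right scaleC_add_left
        scaleC_scaleC scaleC_of_real mop_scaleC_right)+
  show "norm (c *\<^sub>C F) = norm c * norm F"
  proof -
    have "mop (c *\<^sub>C F) = scaleC_blinfun c (mop F)" by transfer simp
    then show ?thesis by (simp add: norm_multiplier_def norm_scaleC_blinfun)
  qed
  have sub: "norm (F * G) \<le> norm F * norm G" for F G :: "'a multiplier"
  proof -
    have "mop (F * G) = mop F o\<^sub>L mop G" by transfer simp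
    then show ?thesis by (simp add: norm_multiplier_def norm_blinfun_compose)
  qed
  then show "norm (F * G) \<le> norm F * norm G" .
  have ns: "norm (star F) = norm F" using norm_madj[of F] by (simp add: norm_multiplier_def)
  show "norm (star F * F) = (norm F)\<^sup>2"
  proof (rule antisym)
    show "norm (star F * F) \<le> (norm F)\<^sup>2" using sub[of "star F" F] ns by (simp add: power2_eq_square)
    have "norm F \<le> sqrt (norm (star F * F))"
      unfolding norm_multiplier_def[of F]
    proof (rule norm_blinfun_bound)
      fix b
      have "(norm (mop F b))\<^sup>2 = norm (star b * mop (star F * F) b)"
        using star_mop_mult[of F b "mop F b"] cstar_identity[of "mop F b"] by simp
      also have "\<dots> \<le> norm b * (norm (star F * F) * norm b)"
        using norm_mult_ineq[of "star b" "mop (star F * F) b"] norm_blinfun[of "mop (star F * F)" b]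
        by (simp add: norm_star norm_multiplier_def) (meson mult_left_mono norm_ge_zero order_trans)
      also have "\<dots> = (sqrt (norm (star F * F)) * norm b)\<^sup>2"
        by (simp add: power_mult_distrib power2_eq_square)
      finally show "norm (mop F b) \<le> sqrt (norm (star F * F)) * norm b"
        by (rule power2_le_imp_le) simp
    qed simp
    then have "(norm F)\<^sup>2 \<le> (sqrt (norm (star F * F)))\<^sup>2" by (rule power_mono) simp
    then show "(norm F)\<^sup>2 \<le> norm (star F * F)" by simp
  qed
qed

end

section \<open>The algebra as an ideal of its multiplier algebra\<close>

lift_definition embed :: "'a::cstar_algebra \<Rightarrow> 'a multiplier"
  is "\<lambda>a. (blinfun_mult_right a, blinfun_mult_right (star a))"
  by (simp add: star_mult mult.assoc)

lemma mop_embed [simp]: "mop (embed a) b = a * b"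
  by transfer simp

lemma embed_simps:
  "embed (a + b) = embed a + embed b" "embed (a - b) = embed a - embed b"
  "embed (a * b) = embed a * embed b" "embed (r *\<^sub>R a) = r *\<^sub>R embed a" "embed (c *\<^sub>C a) = c *\<^sub>C embed a"
  by (rule multiplier_eqI; simp add: blinfun.bilinear_simps algebra_simps mult_scaleC_left)+

lemma embed_star: "embed (star a) = star (embed a)"
  by (rule multiplier_eqI, simp, transfer) simp

lemma norm_embed [simp]: "norm (embed a) = norm a"
proof (rule antisym)
  show "norm (embed a) \<le> norm a"
    unfolding norm_multiplier_def by (rule norm_blinfun_bound) (simp_all add: norm_mult_ineq)
  have "(norm a)\<^sup>2 = norm (mop (embed a) (star a))" by (simp add: cstar_identity')
  also have "\<dots> \<le> norm (embed a) * norm a" unfolding norm_multiplier_def by (metis norm_blinfun norm_star)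
  finally show "norm a \<le> norm (embed a)"
    by (cases "a = 0") (simp_all add: power2_eq_square)
qed

lemma embed_eq_zero_iff [simp]: "embed a = 0 \<longleftrightarrow> a = 0"
  by (metis norm_embed norm_eq_zero)

lemma embed_zero [simp]: "embed 0 = 0"
  by simp

lemma embed_eq_iff [simp]: "embed a = embed b \<longleftrightarrow> a = b"
  using embed_eq_zero_iff[of "a - b"] by (simp add: embed_simps)

text \<open>A multiplier commutes with right multiplication because it has an adjoint; hence the
  embedded algebra is a left ideal.\<close>

lemma mult_embed: "F * embed a = embed (mop F a)"
proof (rule multiplier_eqI)
  fix b
  have "mop F (a * b) = mop F a * b"
  proof (rule eq_if_star_mult_eq)
    show "star d * mop F (a * b) = star d * (mop F a * b)" for d
      using star_mop_mult[of "star F" d "a * b"] star_mop_mult[of "star F" d a]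
      by (simp add: mult.assoc[symmetric])
  qed
  then show "mop (F * embed a) b = mop (embed (mop F a)) b" by simp
qed

lemma embed_mult: "embed a * F = embed (star (mop (star F) (star a)))"
  using arg_cong[OF mult_embed[of "star F" "star a"], of star]
  by (simp add: star_mult star_star embed_star)

section \<open>A discrete Liouville theorem\<close>

text \<open>Cauchy's estimate for a vector-valued polynomial of degree at most \<open>m\<close>, by averaging over the
  \<open>(m + 1)\<close>-st roots of unity; \<open>u\<^sup>m\<close> plays the role of \<open>u\<^sup>-\<^sup>1\<close>.\<close>

lemma norm_linear_coeff_le:
  fixes c :: "nat \<Rightarrow> 'a::complex_banach"
  assumes m: "1 \<le> m" and r: "0 \<le> r"
    and B: "\<And>w. norm w = r \<Longrightarrow> norm (\<Sum>j\<le>m. w ^ j *\<^sub>C c j) \<le> B"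
  shows "r * norm (c 1) \<le> B"
proof -
  define u where "u = exp (2 * of_real pi * \<i> * of_nat 1 / of_nat (Suc m))"
  have up: "u ^ j = exp (2 * of_real pi * \<i> * of_nat j / of_nat (Suc m))" for j
    by (simp add: u_def exp_of_nat_mult[symmetric] mult_ac)
  have u1: "u ^ j = 1 \<longleftrightarrow> Suc m dvd j" for j
    using complex_root_unity_eq[of "Suc m" j 0] by (simp add: up dvd_eq_mod_eq_0)
  have nu: "norm u = 1" by (simp add: u_def)
  \<comment> \<open>For \<open>1 \<le> m\<close> and \<open>j \<le> m\<close>, \<open>Suc m\<close>
    divides \<open>m + j\<close> only if \<open>j = 1\<close>, so averaging isolates the linear
    coefficient.\<close>
  have orth: "(\<Sum>k\<le>m. (u ^ (m + j)) ^ k) = (if j = 1 then of_nat (Suc m) else 0)" if "j \<le> m" for j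
  proof (cases "j = 1")
    case True
    then show ?thesis using u1[of "m + 1"] by simp
  next
    case False
    have "\<not> Suc m dvd m + j"
    proof
      assume "Suc m dvd m + j"
      then obtain q where q: "m + j = Suc m * q" by (elim dvdE)
      have "q < 2"
      proof (rule ccontr)
        assume "\<not> q < 2"
        then have "Suc m * 2 \<le> Suc m * q" by (intro mult_le_mono2) simp
        then show False using q that by simp
      qed
      then consider "q = 0" | "q = 1" by linarith
      then show False using q m False by cases simp_all
    qed
    then have "u ^ (m + j) \<noteq> 1" using u1 by blast
    then have "(\<Sum>k\<le>m. (u ^ (m + j)) ^ k) = ((u ^ (m + j)) ^ Suc m - 1) / (u ^ (m + j) - 1)"
      unfolding lessThan_Suc_atMost[symmetric] by (rule geometric_sum)
    also have "(u ^ (m + j)) ^ Suc m = 1"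
      by (simp only: power_mult[symmetric] u1 dvd_triv_right)
    finally show ?thesis using False by simp
  qed
  define f where "f w = (\<Sum>j\<le>m. w ^ j *\<^sub>C c j)" for w
  have "(\<Sum>k\<le>m. (u ^ m) ^ k *\<^sub>C f (of_real r * u ^ k)) =
      (\<Sum>k\<le>m. \<Sum>j\<le>m. (of_real r ^ j * (u ^ (m + j)) ^ k) *\<^sub>C c j)"
    by (simp add: f_def scaleC_sum_right scaleC_scaleC power_mult_distrib power_add power_mult[symmetric] mult_ac)
  also have "\<dots> = (\<Sum>j\<le>m. (of_real r ^ j * (\<Sum>k\<le>m. (u ^ (m + j)) ^ k)) *\<^sub>C c j)"
    by (subst sum.swap) (simp add: scaleC_sum_left sum_distrib_left)
  also have "\<dots> = (\<Sum>j\<le>m. if j = 1 then (of_real r * of_nat (Suc m)) *\<^sub>C c 1 else 0)"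
    by (rule sum.cong) (simp_all only: orth atMost_iff, auto)
  also have "\<dots> = (of_real r * of_nat (Suc m)) *\<^sub>C c 1" using m by simp
  finally have "(r * real (Suc m)) * norm (c 1) = norm (\<Sum>k\<le>m. (u ^ m) ^ k *\<^sub>C f (of_real r * u ^ k))"
    using r by (simp add: norm_scaleC norm_mult del: of_nat_Suc)
  also have "\<dots> \<le> (\<Sum>k\<le>m. B)"
    using r by (intro sum_norm_le) (simp add: norm_scaleC norm_power norm_mult nu B f_def)
  also have "\<dots> = real (Suc m) * B" by simp
  finally have "real (Suc m) * (r * norm (c 1)) \<le> real (Suc m) * B" by (simp add: mult_ac)
  then show ?thesis by (simp del: of_nat_Suc)
qed

text \<open>Coefficients beyond the degree bound must vanish, so that raising the bound adds only a
  zero term.\<close>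

definition is_poly_fun :: "(complex \<Rightarrow> 'a::complex_banach) \<Rightarrow> nat \<Rightarrow> (nat \<Rightarrow> 'a) \<Rightarrow> bool"
  where "is_poly_fun f m c \<longleftrightarrow> (\<forall>j>m. c j = 0) \<and> (\<forall>w. f w = (\<Sum>j\<le>m. w ^ j *\<^sub>C c j))"

lemma is_poly_fun_step:
  assumes f: "is_poly_fun f m c"
    and add: "\<And>x y. L (x + y) = L x + L y" and sc: "\<And>z x. L (z *\<^sub>C x) = z *\<^sub>C L x"
  shows "is_poly_fun (\<lambda>w. f w + w *\<^sub>C L (f w)) (Suc m) (\<lambda>j. c j + (case j of 0 \<Rightarrow> 0 | Suc i \<Rightarrow> L (c i)))"
proof -
  have L0: "L 0 = 0" using add[of 0 0] by simp
  have Ls: "L (sum g A) = (\<Sum>i\<in>A. L (g i))" for g :: "nat \<Rightarrow> 'a" and A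
    by (induction A rule: infinite_finite_induct) (simp_all add: L0 add)
  have cm: "c (Suc m) = 0" using f by (simp add: is_poly_fun_def)
  have "(\<Sum>j\<le>Suc m. w ^ j *\<^sub>C (c j + (case j of 0 \<Rightarrow> 0 | Suc i \<Rightarrow> L (c i)))) = f w + w *\<^sub>C L (f w)" for w
  proof -
    have "(\<Sum>j\<le>Suc m. w ^ j *\<^sub>C (c j + (case j of 0 \<Rightarrow> 0 | Suc i \<Rightarrow> L (c i)))) =
        (\<Sum>j\<le>Suc m. w ^ j *\<^sub>C c j) + (\<Sum>j\<le>Suc m. w ^ j *\<^sub>C (case j of 0 \<Rightarrow> 0 | Suc i \<Rightarrow> L (c i)))"
      by (simp only: scaleC_add_right sum.distrib)
    also have "(\<Sum>j\<le>Suc m. w ^ j *\<^sub>C c j) = f w"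
      using f by (simp add: is_poly_fun_def cm)
    also have "(\<Sum>j\<le>Suc m. w ^ j *\<^sub>C (case j of 0 \<Rightarrow> 0 | Suc i \<Rightarrow> L (c i))) = (\<Sum>j\<le>m. w ^ Suc j *\<^sub>C L (c j))"
      by (subst sum.atMost_Suc_shift) simp
    also have "\<dots> = w *\<^sub>C L (f w)"
      using f by (simp add: is_poly_fun_def Ls sc scaleC_sum_right scaleC_scaleC)
    finally show ?thesis .
  qed
  then show ?thesis using f by (auto simp: is_poly_fun_def L0 split: nat.split)
qed

text \<open>Each increase of \<open>n\<close> multiplies by \<open>1 + w h\<close> on the left and
  \<open>1 - w h\<close> on the right, adding one commutator to the linear coefficient.\<close>

lemma conjugated_power_poly:
  fixes h k :: "'a::unital_cstar_algebra"
  shows "\<exists>c. is_poly_fun (\<lambda>w. (1 + w *\<^sub>C h) ^ n * k * (1 - w *\<^sub>C h) ^ n) (2 * n) c \<and> c 0 = k \<and>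
    c 1 = real n *\<^sub>R (h * k - k * h)"
proof (induction n)
  case 0
  show ?case by (rule exI[of _ "\<lambda>j. if j = 0 then k else 0"]) (simp add: is_poly_fun_def)
next
  case (Suc n)
  define F where "F w = (1 + w *\<^sub>C h) ^ n * k * (1 - w *\<^sub>C h) ^ n" for w
  from Suc obtain c where c: "is_poly_fun F (2 * n) c" "c 0 = k" "c 1 = real n *\<^sub>R (h * k - k * h)"
    unfolding F_def by blast
  define G where "G w = F w + w *\<^sub>C (h * F w)" for w
  define d where "d j = c j + (case j of 0 \<Rightarrow> 0 | Suc i \<Rightarrow> h * c i)" for j
  have G: "is_poly_fun G (Suc (2 * n)) d"
    unfolding G_def d_def by (rule is_poly_fun_step[OF c(1)]) (simp_all add: distrib_left mult_scaleC_right)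
  have "is_poly_fun (\<lambda>w. G w + w *\<^sub>C - (G w * h)) (Suc (Suc (2 * n)))
      (\<lambda>j. d j + (case j of 0 \<Rightarrow> 0 | Suc i \<Rightarrow> - (d i * h)))"
    by (rule is_poly_fun_step[OF G]) (simp_all add: distrib_right mult_scaleC_left scaleC_minus_right)
  moreover have "(1 + w *\<^sub>C h) ^ Suc n * k * (1 - w *\<^sub>C h) ^ Suc n = G w + w *\<^sub>C - (G w * h)" for w
  proof -
    have "(1 + w *\<^sub>C h) ^ Suc n * k * (1 - w *\<^sub>C h) ^ Suc n = (1 + w *\<^sub>C h) * F w * (1 - w *\<^sub>C h)"
      by (simp only: F_def power_Suc power_Suc2[of "1 - w *\<^sub>C h"] mult.assoc)
         (simp only: power_Suc[symmetric] power_Suc2 mult.assoc)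
    also have "(1 + w *\<^sub>C h) * F w = G w" by (simp add: G_def distrib_right mult_scaleC_left)
    finally show ?thesis by (simp add: right_diff_distrib mult_scaleC_right scaleC_minus_right)
  qed
  moreover have "d 0 = k" "d 1 + - (d 0 * h) = real (Suc n) *\<^sub>R (h * k - k * h)"
    using c by (simp_all add: d_def algebra_simps)
  ultimately show ?case by (intro exI[of _ "\<lambda>j. d j + (case j of 0 \<Rightarrow> 0 | Suc i \<Rightarrow> - (d i * h))"]) simp
qed

text \<open>A discrete Liouville argument: \<open>e\<^sup>z\<^sup>h k e\<^sup>-\<^sup>z\<^sup>h\<close> is bounded in \<open>z\<close>, hence constant. Using
  \<open>(1 + w h)\<^sup>n\<close> with \<open>\<bar>w\<bar> = n\<^sup>-\<^sup>1\<^sup>/\<^sup>2\<close> in place of the exponential leaves only polynomials.\<close>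

lemma commute_of_norm_le:
  fixes h k :: "'a::unital_cstar_algebra"
  assumes C: "C \<ge> 0"
    and le: "\<And>w n. norm ((1 + w *\<^sub>C h) ^ n * k * (1 - w *\<^sub>C h) ^ n) \<le>
      C * norm ((1 + w *\<^sub>C h) ^ n * h * (1 - w *\<^sub>C h) ^ n)"
  shows "h * k = k * h"
proof -
  define B where "B = C * (norm h * exp ((norm h)\<^sup>2))"
  have bound: "sqrt (real n) * norm (h * k - k * h) \<le> B" if n: "n \<ge> 1" for n
  proof -
    \<comment> \<open>This radius keeps \<open>(1 + r^2 * (norm h)^2)^n\<close> below an
      exponential, while \<open>n * r = sqrt n\<close> still tends to infinity.\<close>
    define r where "r = 1 / sqrt (real n)"
    have r: "r > 0" "real n * r = sqrt (real n)" "r\<^sup>2 = 1 / real n"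
      using n by (simp_all add: r_def power_divide real_div_sqrt)
    obtain c where c: "is_poly_fun (\<lambda>w. (1 + w *\<^sub>C h) ^ n * k * (1 - w *\<^sub>C h) ^ n) (2 * n) c"
      "c 1 = real n *\<^sub>R (h * k - k * h)" using conjugated_power_poly by blast
    have "r * norm (c 1) \<le> B"
    proof (rule norm_linear_coeff_le[of "2 * n"])
      fix w :: complex assume w: "norm w = r"
      define a where "a = 1 + w *\<^sub>C h"
      define d where "d = 1 - w *\<^sub>C h"
      have ad: "a * d = 1 - (w * w) *\<^sub>C (h * h)" "d * a = a * d" "a * h = h * a"
        by (simp_all add: a_def d_def algebra_simps mult_scaleC_left mult_scaleC_right scaleC_scaleC
            scaleC_add_right scaleC_diff_right)
      \<comment> \<open>Here \<open>a\<close>, \<open>d\<close> and \<open>h\<close> commute, and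
        the first-order terms cancel in \<open>a * d = 1 - w^2 h^2\<close>.\<close>
      have "a ^ i * h * d ^ i = h * (a * d) ^ i" for i
      proof (induction i)
        case (Suc i)
        have "a ^ Suc i * h * d ^ Suc i = a * (a ^ i * h * d ^ i) * d"
          by (simp only: power_Suc power_Suc2[of d] mult.assoc)
             (simp only: power_Suc[symmetric] power_Suc2 mult.assoc)
        also have "\<dots> = h * (a * ((a * d) ^ i * d))" by (simp add: Suc mult.assoc[symmetric] ad)
        also have "(a * d) ^ i * d = d * (a * d) ^ i"
          by (rule power_commute_left[symmetric]) (metis ad(2) mult.assoc)
        finally show ?case by (simp add: mult.assoc)
      qed simp
      then have hn: "norm (a ^ n * h * d ^ n) \<le> norm h * norm ((a * d) ^ n)" using norm_mult_ineq by simp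
      have "norm (a * d) \<le> norm (1::'a) + norm ((w * w) *\<^sub>C (h * h))"
        unfolding ad by (rule norm_triangle_ineq4)
      also have "norm ((w * w) *\<^sub>C (h * h)) \<le> r\<^sup>2 * (norm h)\<^sup>2"
        using norm_mult_ineq[of h h] by (simp add: norm_scaleC norm_mult w power2_eq_square mult_left_mono)
      finally have "norm (a * d) \<le> 1 + (norm h)\<^sup>2 / real n" using norm_one_le[where 'a='a] r by simp
      also have "\<dots> \<le> exp ((norm h)\<^sup>2 / real n)" by (rule exp_ge_add_one_self)
      finally have "norm (a * d) ^ n \<le> exp ((norm h)\<^sup>2 / real n) ^ n" by (rule power_mono) simp
      also have "exp ((norm h)\<^sup>2 / real n) ^ n = exp ((norm h)\<^sup>2)"
        using n by (simp add: exp_of_nat_mult[symmetric])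
      finally have "norm ((a * d) ^ n) \<le> exp ((norm h)\<^sup>2)" using norm_power_le order_trans by blast
      then have "norm h * norm ((a * d) ^ n) \<le> norm h * exp ((norm h)\<^sup>2)" by (rule mult_left_mono) simp
      then have "norm (a ^ n * h * d ^ n) \<le> norm h * exp ((norm h)\<^sup>2)" using hn by linarith
      then have "C * norm (a ^ n * h * d ^ n) \<le> B" unfolding B_def using C by (rule mult_left_mono)
      then have "norm (a ^ n * k * d ^ n) \<le> B" using le[of w n] unfolding a_def d_def by linarith
      then show "norm (\<Sum>j\<le>2 * n. w ^ j *\<^sub>C c j) \<le> B"
        using c(1) by (simp add: is_poly_fun_def a_def d_def)
    qed (use n r in simp_all)
    moreover have "r * norm (c 1) = (real n * r) * norm (h * k - k * h)"
      unfolding c(2) by (simp only: norm_scaleR abs_of_nat mult_ac)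
    ultimately show ?thesis by (simp only: r)
  qed
  have "norm (h * k - k * h) = 0"
  proof (rule ccontr)
    assume "norm (h * k - k * h) \<noteq> 0"
    then have pos: "norm (h * k - k * h) > 0" by simp
    obtain n :: nat where n: "(B / norm (h * k - k * h))\<^sup>2 < real n" using reals_Archimedean2 by blast
    then have n1: "n \<ge> 1" by (metis One_nat_def Suc_leI gr0I not_less of_nat_0 zero_le_power2)
    have "B / norm (h * k - k * h) < sqrt (real n)" using n by (rule real_less_rsqrt)
    then show False using bound[OF n1] pos by (simp add: divide_less_eq)
  qed
  then show ?thesis by simp
qed

section \<open>Hilbert modules\<close>

context hilbert_module
begin

section \<open>Sesquilinearity and a Cauchy-Schwarz estimate\<close>

lemma inner_add_right: "inn x (y + z) = inn x y + inn x z"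
  by (metis inner_add_left inner_commute star_add)

lemma inner_scaleC_right: "inn x (c *\<^sub>C y) = cnj c *\<^sub>C inn x y"
  by (metis inner_commute inner_scaleC_left star_scaleC)

lemma inner_act_right: "inn x (act a y) = inn x y * star a"
  by (metis inner_act_left inner_commute star_mult)

lemma inner_minus_left: "inn (- x) y = - inn x y"
  using inner_scaleC_left[of "-1" x y] by (simp add: scaleC_minus_left)

lemma inner_minus_right: "inn x (- y) = - inn x y"
  by (metis inner_commute inner_minus_left star_minus)

lemma inner_diff_left: "inn (x - y) z = inn x z - inn y z"
  using inner_add_left[of x "- y" z] by (simp add: inner_minus_left)

lemma inner_diff_right: "inn x (y - z) = inn x y - inn x z"
  using inner_add_right[of x y "- z"] by (simp add: inner_minus_right)

lemma inner_zero [simp]: "inn 0 y = 0" "inn x 0 = 0"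
  using inner_diff_left[of 0 0 y] inner_diff_right[of x 0 0] by simp_all

lemma norm_squared_eq: "(norm x)\<^sup>2 = norm (inn x x)"
  by (simp add: norm_eq_sqrt_inner)

lemma polarization:
  "4 *\<^sub>R inn x y = inn (x + y) (x + y) - inn (x - y) (x - y)
    + \<i> *\<^sub>C inn (x + \<i> *\<^sub>C y) (x + \<i> *\<^sub>C y) - \<i> *\<^sub>C inn (x - \<i> *\<^sub>C y) (x - \<i> *\<^sub>C y)"
proof -
  have "4 *\<^sub>R inn x y = inn x y + inn x y + (inn x y + inn x y)"
    by (metis mult_2 numeral_Bit0 scaleR_2 scaleR_add_left)
  then show ?thesis
    by (simp add: inner_add_left inner_add_right inner_diff_left inner_diff_right inner_scaleC_left
        inner_scaleC_right scaleC_add_right scaleC_diff_right scaleC_scaleC scaleC_minus_left scaleC_minus_right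
        algebra_simps)
qed

text \<open>Polarization and the triangle inequality already give Cauchy--Schwarz up to a constant,
  which suffices here.\<close>

lemma norm_inner_le: "norm (inn x y) \<le> 4 * norm x * norm y"
proof -
  have unit: "norm (inn x y) \<le> 4" if "norm x \<le> 1" "norm y \<le> 1" for x y
  proof -
    have sq: "norm (inn z z) \<le> 4" if "norm z \<le> 2" for z
      using power_mono[OF that norm_ge_zero, of 2] by (simp add: norm_squared_eq)
    have iy: "norm (\<i> *\<^sub>C y) \<le> 1" using that by (simp add: norm_scaleC)
    have "norm (x + y) \<le> 2" "norm (x - y) \<le> 2" "norm (x + \<i> *\<^sub>C y) \<le> 2" "norm (x - \<i> *\<^sub>C y) \<le> 2"
      using that iy norm_triangle_ineq[of x y] norm_triangle_ineq4[of x y]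
        norm_triangle_ineq[of x "\<i> *\<^sub>C y"] norm_triangle_ineq4[of x "\<i> *\<^sub>C y"] by linarith+
    note b = this[THEN sq]
    have tri: "norm (p - q + r - s) \<le> norm p + norm q + norm r + norm s" for p q r s :: 'a
      using norm_triangle_ineq4[of "p - q + r" s] norm_triangle_ineq[of "p - q" r] norm_triangle_ineq4[of p q]
      by linarith
    \<comment> \<open>All four vectors have norm at most \<open>2\<close>, so each term contributes
      at most \<open>4\<close>.\<close>
    have "norm (4 *\<^sub>R inn x y) \<le> 4 + 4 + 4 + 4"
      unfolding polarization by (rule order_trans[OF tri]) (use b in \<open>simp add: norm_scaleC\<close>)
    then show ?thesis by simp
  qed
  show ?thesis
  proof (cases "x = 0 \<or> y = 0")
    case False
    define x' where "x' = complex_of_real (1 / norm x) *\<^sub>C x"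
    define y' where "y' = complex_of_real (1 / norm y) *\<^sub>C y"
    have "norm x' \<le> 1" "norm y' \<le> 1" using False by (simp_all add: x'_def y'_def norm_scaleC norm_divide)
    then have "norm (inn x' y') \<le> 4" by (rule unit)
    moreover have "norm (inn x' y') = norm (inn x y) / (norm x * norm y)"
      by (simp add: x'_def y'_def inner_scaleC_left inner_scaleC_right norm_scaleC norm_divide)
    ultimately show ?thesis using False by (simp add: divide_le_eq mult.assoc)
  qed auto
qed

text \<open>\<open>implements F S\<close>: the operator \<open>S\<close> on the module is the action of \<open>F = c 1 + a\<close>, an element of
  the unitization of the algebra inside its multiplier algebra.\<close>

definition implements :: "'a multiplier \<Rightarrow> ('m \<Rightarrow> 'm) \<Rightarrow> bool"
  where "implements F S \<longleftrightarrow> (\<exists>c a. F = c *\<^sub>C 1 + embed a \<and> S = (\<lambda>x. c *\<^sub>C x + act a x))"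

lemma implementsI: "F = c *\<^sub>C 1 + embed a \<Longrightarrow> \<exists>S. implements F S"
  by (auto simp: implements_def)

lemma implements_one: "implements 1 (\<lambda>x. x)"
proof -
  have "act 0 x = 0" for x using act_add_left[of 0 0 x] by simp
  then show ?thesis unfolding implements_def by (intro exI[of _ 1] exI[of _ 0]) simp
qed

lemma implements_mult:
  assumes "implements F S" "implements G R"
  shows "implements (F * G) (\<lambda>x. S (R x))"
proof -
  obtain c a where S: "F = c *\<^sub>C 1 + embed a" "S = (\<lambda>x. c *\<^sub>C x + act a x)"
    using assms(1) by (auto simp: implements_def)
  obtain d b where R: "G = d *\<^sub>C 1 + embed b" "R = (\<lambda>x. d *\<^sub>C x + act b x)"
    using assms(2) by (auto simp: implements_def)
  have "F * G = (c * d) *\<^sub>C 1 + embed (c *\<^sub>C b + d *\<^sub>C a + a * b)"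
    by (simp add: S R embed_simps algebra_simps mult_scaleC_left mult_scaleC_right scaleC_scaleC scaleC_add_right)
  moreover have "S (R x) = (c * d) *\<^sub>C x + act (c *\<^sub>C b + d *\<^sub>C a + a * b) x" for x
    by (simp add: S R act_add_left act_add_right act_mult act_scaleC_left act_scaleC_right
        scaleC_scaleC scaleC_add_right add_ac)
  ultimately show ?thesis unfolding implements_def by blast
qed

lemma implements_power: "\<exists>S. implements F S \<Longrightarrow> \<exists>S. implements (F ^ n) S"
proof (induction n)
  case 0
  then show ?case using implements_one by auto
next
  case (Suc n)
  then show ?case using implements_mult by (simp only: power_Suc) blast
qed

lemma embed_inner_implements:
  assumes "implements F S" "implements G R"
  shows "embed (inn (S x) (R y)) = F * embed (inn x y) * star G"
proof -
  obtain c a where S: "F = c *\<^sub>C 1 + embed a" "S = (\<lambda>x. c *\<^sub>C x + act a x)"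
    using assms(1) by (auto simp: implements_def)
  obtain d b where R: "G = d *\<^sub>C 1 + embed b" "R = (\<lambda>x. d *\<^sub>C x + act b x)"
    using assms(2) by (auto simp: implements_def)
  show ?thesis
    by (simp add: S R inner_add_left inner_add_right inner_scaleC_left inner_scaleC_right inner_act_left
        inner_act_right embed_simps embed_star star_add star_scaleC algebra_simps mult_scaleC_left mult_scaleC_right
        scaleC_scaleC scaleC_add_right)
qed

lemma module_map_implements:
  assumes "module_map act T" "implements F S" shows "T (S x) = S (T x)"
  using assms by (auto simp: module_map_def implements_def)

lemma psd_embed_inner: "psd (embed (inn x x))"
proof -
  obtain b where "inn x x = star b * b" using inner_positive[of x] by (auto simp: positive_element_def)
  then show ?thesis using psd_star_mult_self[of "embed b"] by (simp add: embed_simps embed_star)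
qed

text \<open>Solving the defining equation gives \<open>v = (1 - v * embed a) / e\<close>, and
  \<open>v * embed a\<close> lies in the ideal.\<close>

lemma implements_inverse:
  assumes a: "psd (embed a)" and e: "e > 0" and v: "v * (embed a + e *\<^sub>R 1) = 1"
  shows "\<exists>S. implements v S"
proof -
  have "v = (1 / e) *\<^sub>R 1 - (1 / e) *\<^sub>R (v * embed a)"
    using arg_cong[OF v, of "\<lambda>z. (1 / e) *\<^sub>R z"] e by (simp add: distrib_left scaleR_add_right eq_diff_eq add.commute)
  also have "\<dots> = of_real (1 / e) *\<^sub>C 1 + embed (- ((1 / e) *\<^sub>R mop v a))"
    using embed_simps(2)[of 0 "(1 / e) *\<^sub>R mop v a"]
    by (simp add: scaleC_of_real mult_embed embed_simps del: of_real_divide)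
  finally show ?thesis by (rule implementsI)
qed

text \<open>With \<open>t = sqrt e\<close>, factoring \<open>s * s - t * t\<close> gives
  \<open>s - t = embed a * v\<close> for the inverse \<open>v\<close> of \<open>s + t\<close>. Thus
  \<open>s\<close>, and then \<open>R\<close>, is a scalar plus an element of the ideal.\<close>

lemma implements_sqrt:
  assumes s: "psd s" "s * s = embed a + e *\<^sub>R 1" and e: "e > 0" and R: "R * s = 1"
  shows "\<exists>S. implements s S" "\<exists>S. implements R S"
proof -
  define t where "t = sqrt e"
  have t: "t > 0" "t * t = e" using e by (simp_all add: t_def)
  obtain v where v: "(s + t *\<^sub>R 1) * v = 1" by (rule psd_add_scaleR_inverse[OF s(1) t(1)]) blast
  have "(s - t *\<^sub>R 1) * (s + t *\<^sub>R 1) = embed a"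
    by (simp add: algebra_simps s(2)) (simp add: t scaleR_scaleR[symmetric] del: scaleR_scaleR)
  then have "s - t *\<^sub>R 1 = embed a * v" by (metis v mult.assoc mult_1_right)
  then obtain b where b: "s - t *\<^sub>R 1 = embed b" using embed_mult by metis
  have sb: "s = of_real t *\<^sub>C 1 + embed b" using b by (simp add: scaleC_of_real algebra_simps)
  then show "\<exists>S. implements s S" by (rule implementsI)
  have "R * (t *\<^sub>R 1 + embed b) = 1" using R sb by (simp add: scaleC_of_real)
  then have "(1 / t) *\<^sub>R (t *\<^sub>R R + embed (mop R b)) = (1 / t) *\<^sub>R 1"
    by (simp add: distrib_left mult_embed)
  then have "R = (1 / t) *\<^sub>R 1 - (1 / t) *\<^sub>R embed (mop R b)"
    using t(1) by (simp add: scaleR_add_right eq_diff_eq)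
  also have "\<dots> = of_real (1 / t) *\<^sub>C 1 + embed (0 - ((1 / t) *\<^sub>R mop R b))"
    by (simp only: scaleC_of_real embed_simps) simp
  finally show "\<exists>S. implements R S" by (rule implementsI)
qed

text \<open>In the hypothesis, \<open>R\<close> ranges over the elements \<open>(h + e)\<^sup>-\<^sup>1\<^sup>/\<^sup>2\<close> for \<open>h\<close> either of the two
  inner squares.\<close>

lemma inner_self_eq_scaleR:
  assumes l: "l > 0"
    and eq: "\<And>R s S S'. implements R S \<Longrightarrow> implements s S' \<Longrightarrow> star R = R \<Longrightarrow> star s = s \<Longrightarrow> R * s = 1 \<Longrightarrow> s * R = 1 \<Longrightarrow>
      (\<And>c. c * embed (inn x x) = embed (inn x x) * c \<Longrightarrow> c * embed (inn y y) = embed (inn y y) * c \<Longrightarrow>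
        c * R = R * c \<and> c * s = s * c) \<Longrightarrow> norm (S y) = l * norm (S x)"
  shows "inn y y = l\<^sup>2 *\<^sub>R inn x x"
proof -
  define h where "h = embed (inn x x)"
  define k where "k = embed (inn y y)"
  have ph: "psd h" and pk: "psd k" by (simp_all add: h_def k_def psd_embed_inner)
  have inv_comm: "c * R = R * c" if "c * s = s * c" "R * s = 1" "s * R = 1" for c R s :: "'a multiplier"
  proof -
    have "c * R = (R * s) * (c * R)" by (simp add: that)
    also have "\<dots> = R * (c * s) * R" by (simp add: that(1) mult.assoc)
    also have "\<dots> = R * c * (s * R)" by (simp only: mult.assoc)
    finally show ?thesis by (simp add: that)
  qed
  \<comment> \<open>Allowing \<open>a\<close> to be either inner square serves both order
    inequalities.\<close>
  have key: "norm (R * k * R) = l\<^sup>2 * norm (R * h * R)"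
    if a: "a = inn x x \<or> a = inn y y" and e: "e > 0" and s: "psd s" "s * s = embed a + e *\<^sub>R 1"
      and sc: "\<And>c. c * embed a = embed a * c \<Longrightarrow> c * s = s * c"
      and R: "star R = R" "R * s = 1" "s * R = 1" for a e s R
  proof -
    obtain S' S where S: "implements s S'" "implements R S"
      using implements_sqrt[OF s e R(2)] by blast
    have "norm (S y) = l * norm (S x)"
    proof (rule eq[OF S(2) S(1) R(1) psd_selfadjoint[OF s(1)] R(2,3)])
      fix c assume "c * embed (inn x x) = embed (inn x x) * c" "c * embed (inn y y) = embed (inn y y) * c"
      then have "c * s = s * c" using a by (intro sc) auto
      then show "c * R = R * c \<and> c * s = s * c" using inv_comm R by blast
    qed
    then have "(norm (S y))\<^sup>2 = l\<^sup>2 * (norm (S x))\<^sup>2" by (simp add: power_mult_distrib)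
    then have "norm (embed (inn (S y) (S y))) = l\<^sup>2 * norm (embed (inn (S x) (S x)))"
      by (simp add: norm_squared_eq)
    then show ?thesis by (simp add: embed_inner_implements[OF S(2) S(2)] h_def k_def R(1))
  qed
  have l2: "l\<^sup>2 > 0" using l by simp
  have "psd (h - (1 / l\<^sup>2) *\<^sub>R k)"
  proof (rule psd_diff_of_norm_le[OF ph])
    show "star ((1 / l\<^sup>2) *\<^sub>R k) = (1 / l\<^sup>2) *\<^sub>R k" by (simp add: star_scaleR psd_selfadjoint pk)
    fix e s R
    assume "e > 0" "psd s" "s * s = h + e *\<^sub>R 1" "\<And>c. c * h = h * c \<Longrightarrow> c * s = s * c"
      "star R = R" "R * s = 1" "s * R = 1"
    then have "norm (R * k * R) = l\<^sup>2 * norm (R * h * R)"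
      by (rule key[OF disjI1[OF refl], folded h_def])
    then show "norm (R * (1 / l\<^sup>2) *\<^sub>R k * R) \<le> norm (R * h * R)" using l2 by simp
  qed
  then have "psd (l\<^sup>2 *\<^sub>R (h - (1 / l\<^sup>2) *\<^sub>R k))" by (rule psd_scaleR) simp
  then have 1: "psd (l\<^sup>2 *\<^sub>R h - k)" using l2 by (simp add: scaleR_diff_right)
  have "psd (k - l\<^sup>2 *\<^sub>R h)"
  proof (rule psd_diff_of_norm_le[OF pk])
    show "star (l\<^sup>2 *\<^sub>R h) = l\<^sup>2 *\<^sub>R h" by (simp add: star_scaleR psd_selfadjoint ph)
    fix e s R
    assume "e > 0" "psd s" "s * s = k + e *\<^sub>R 1" "\<And>c. c * k = k * c \<Longrightarrow> c * s = s * c"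
      "star R = R" "R * s = 1" "s * R = 1"
    then have "norm (R * k * R) = l\<^sup>2 * norm (R * h * R)"
      by (rule key[OF disjI2[OF refl], folded k_def])
    then show "norm (R * l\<^sup>2 *\<^sub>R h * R) \<le> norm (R * k * R)" by simp
  qed
  then have "psd (- (l\<^sup>2 *\<^sub>R h - k))" by simp
  then have "l\<^sup>2 *\<^sub>R h - k = 0" using 1 psd_antisym by blast
  then have "embed (inn y y) = embed (l\<^sup>2 *\<^sub>R inn x x)" by (simp add: h_def k_def embed_simps)
  then show ?thesis by simp
qed

lemma inner_isometric:
  assumes U: "isometric_module_operator act U"
  shows "inn (U x) (U y) = inn x y"
proof -
  have m: "module_map act U" and n: "norm (U z) = norm z" for z
    using U by (auto simp: isometric_module_operator_def)
  have add: "U (z + w) = U z + U w" and sc: "U (c *\<^sub>C z) = c *\<^sub>C U z" for z w c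
    using m by (auto simp: module_map_def)
  have diff: "U (z - w) = U z - U w" for z w
    using add[of z "- w"] sc[of "-1" w] by (simp add: scaleC_minus_left)
  \<comment> \<open>\<open>U\<close> commutes with every implemented \<open>S\<close>, so
    \<open>S (U z)\<close> has the norm of \<open>S z\<close>.\<close>
  have self: "inn (U z) (U z) = inn z z" for z
    using inner_self_eq_scaleR[of 1 "U z" z] by (simp add: module_map_implements[OF m, symmetric] n)
  have "4 *\<^sub>R inn (U x) (U y) = 4 *\<^sub>R inn x y"
    unfolding polarization by (simp only: add[symmetric] diff[symmetric] sc[symmetric] self)
  then show ?thesis by simp
qed

end

section \<open>Conformal maps\<close>

context hilbert_module
begin

lemma implements_unique:
  assumes "implements F S" "implements F S'" shows "S x = S' x"
proof -
  have "embed (inn (S x - S' x) (S x - S' x)) = 0"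
    using assms by (simp add: inner_diff_left inner_diff_right embed_simps embed_inner_implements)
  then show ?thesis using inner_eq_zero_iff[of "S x - S' x"] by simp
qed

end

locale conformal_map = hilbert_module act inn
  for act :: "'a::cstar_algebra \<Rightarrow> 'm::complex_banach \<Rightarrow> 'm" and inn :: "'m \<Rightarrow> 'm \<Rightarrow> 'a" +
  fixes T :: "'m \<Rightarrow> 'm"
  assumes conformal: "conformal act inn T"
begin

text \<open>At \<open>0\<close> this takes the default value \<open>0\<close>, since division by
  zero yields zero.\<close>

definition ratio :: "'m \<Rightarrow> real" where "ratio x = norm (T x) / norm x"

lemma module_map: "module_map act T"
  using conformal by (simp add: conformal_def bounded_module_map_def)

lemma T_add: "T (x + y) = T x + T y" and T_scaleC: "T (c *\<^sub>C x) = c *\<^sub>C T x" and T_act: "T (act a x) = act a (T x)"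
  using module_map by (simp_all add: module_map_def)

lemma T_zero [simp]: "T 0 = 0"
  using T_add[of 0 0] by simp

lemma T_diff: "T (x - y) = T x - T y"
  using T_add[of x "- y"] T_scaleC[of "-1" y] by (simp add: scaleC_minus_left)

lemma T_eq_zero_iff [simp]: "T x = 0 \<longleftrightarrow> x = 0"
  using conformal T_zero by (metis conformal_def injD)

lemma ratio_pos: "x \<noteq> 0 \<Longrightarrow> ratio x > 0"
  by (simp add: ratio_def)

lemma ratio_nonneg: "ratio x \<ge> 0"
  by (simp add: ratio_def)

lemma norm_T: "norm (T x) = ratio x * norm x"
  by (cases "x = 0") (simp_all add: ratio_def)

lemma norm_inner_T: "norm (inn (T x) (T y)) = ratio x * ratio y * norm (inn x y)"
proof (cases "x = 0 \<or> y = 0")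
  case False
  then have "norm (inn (T x) (T y)) / (norm (T x) * norm (T y)) = norm (inn x y) / (norm x * norm y)"
    using conformal by (simp add: conformal_def)
  then show ?thesis using False by (simp add: ratio_def field_simps)
qed auto

lemma ratio_bounded: obtains K where "K \<ge> 0" "\<And>x. ratio x \<le> K"
proof -
  obtain K where K: "\<And>x. norm (T x) \<le> K * norm x"
    using conformal by (auto simp: conformal_def bounded_module_map_def)
  have "ratio x \<le> max K 0" for x
    using K[of x] by (cases "x = 0") (simp_all add: ratio_def divide_le_eq le_max_iff_disj)
  then show ?thesis using that[of "max K 0"] by simp
qed

lemma norm_inner_T_le: obtains C where "C \<ge> 0" "\<And>x y. norm (inn (T x) (T y)) \<le> C * norm (inn x y)"
proof -
  obtain K where K: "K \<ge> 0" "\<And>x. ratio x \<le> K" by (rule ratio_bounded) blast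
  have "norm (inn (T x) (T y)) \<le> K * K * norm (inn x y)" for x y
    unfolding norm_inner_T using K ratio_nonneg by (intro mult_right_mono mult_mono) simp_all
  then show ?thesis using that[of "K * K"] K(1) by simp
qed

lemma inner_T_commute:
  "embed (inn x x) * embed (inn (T x) (T x)) = embed (inn (T x) (T x)) * embed (inn x x)"
proof -
  obtain C where C: "C \<ge> 0" "\<And>x y. norm (inn (T x) (T y)) \<le> C * norm (inn x y)"
    by (rule norm_inner_T_le) blast
  define h where "h = embed (inn x x)"
  have h: "star h = h" by (simp add: h_def psd_selfadjoint psd_embed_inner)
  show ?thesis
    unfolding h_def[symmetric]
  proof (rule commute_of_norm_le[OF C(1)])
    fix w n
    have "\<exists>S. implements (1 + z *\<^sub>C h) S" for z
      by (rule implementsI[of _ 1 "z *\<^sub>C inn x x"]) (simp add: h_def embed_simps)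
    then have "\<exists>S. implements ((1 + z *\<^sub>C h) ^ n) S" for z by (rule implements_power)
    \<comment> \<open>The coefficient \<open>- cnj w\<close> makes the adjoint of the second power
      equal to \<open>(1 - w h)^n\<close>, as \<open>h\<close> is self-adjoint.\<close>
    then obtain S R where S: "implements ((1 + w *\<^sub>C h) ^ n) S" and R: "implements ((1 + (- cnj w) *\<^sub>C h) ^ n) R"
      by blast
    have sR: "star ((1 + (- cnj w) *\<^sub>C h) ^ n) = (1 - w *\<^sub>C h) ^ n"
      by (simp add: star_power star_diff star_scaleC h scaleC_minus_left)
    have "norm ((1 + w *\<^sub>C h) ^ n * embed (inn (T x) (T x)) * (1 - w *\<^sub>C h) ^ n) = norm (inn (T (S x)) (T (R x)))"
      using embed_inner_implements[OF S R, of "T x" "T x"] norm_embed[of "inn (T (S x)) (T (R x))"]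
      by (simp only: sR module_map_implements[OF module_map S] module_map_implements[OF module_map R])
    also have "\<dots> \<le> C * norm (inn (S x) (R x))" by (rule C(2))
    also have "norm (inn (S x) (R x)) = norm ((1 + w *\<^sub>C h) ^ n * h * (1 - w *\<^sub>C h) ^ n)"
      using embed_inner_implements[OF S R, of x x] norm_embed[of "inn (S x) (R x)"]
      by (simp only: sR h_def[symmetric])
    finally show "norm ((1 + w *\<^sub>C h) ^ n * embed (inn (T x) (T x)) * (1 - w *\<^sub>C h) ^ n) \<le>
        C * norm ((1 + w *\<^sub>C h) ^ n * h * (1 - w *\<^sub>C h) ^ n)" .
  qed
qed

text \<open>On invertible selfadjoint elements \<open>P\<close> commuting with \<open>\<langle>x, x\<rangle>\<close> and \<open>\<langle>Tx, Tx\<rangle>\<close> the map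
  \<open>P \<mapsto> ratio (P x) / ratio x\<close> is multiplicative; being bounded on the powers of \<open>P\<close> and of
  \<open>P\<^sup>-\<^sup>1\<close>, it is constantly one.\<close>

lemma ratio_mult:
  assumes x: "x \<noteq> 0" and P: "implements P A" and Q: "implements Q B" "star Q = Q"
    and comm: "embed (inn x x) * Q = Q * embed (inn x x)"
      "embed (inn (T x) (T x)) * Q = Q * embed (inn (T x) (T x))"
    and inv: "Z * (P * Q) = 1"
  shows "ratio (A x) * ratio (B x) = ratio (A (B x)) * ratio x"
proof -
  note PQ = implements_mult[OF P Q(1)]
  have h: "inn (A x) (B x) = inn (A (B x)) x"
  proof -
    have "embed (inn (A x) (B x)) = P * (embed (inn x x) * Q)"
      by (simp add: embed_inner_implements[OF P Q(1)] Q(2) mult.assoc)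
    also have "\<dots> = embed (inn (A (B x)) x)"
      using embed_inner_implements[OF PQ implements_one, of x x] by (simp add: comm mult.assoc)
    finally show ?thesis by simp
  qed
  have k: "inn (T (A x)) (T (B x)) = inn (T (A (B x))) (T x)"
  proof -
    have "embed (inn (A (T x)) (B (T x))) = P * (embed (inn (T x) (T x)) * Q)"
      by (simp add: embed_inner_implements[OF P Q(1)] Q(2) mult.assoc)
    also have "\<dots> = embed (inn (A (B (T x))) (T x))"
      using embed_inner_implements[OF PQ implements_one, of "T x" "T x"] by (simp add: comm mult.assoc)
    finally show ?thesis
      by (simp add: module_map_implements[OF module_map P] module_map_implements[OF module_map Q(1)])
  qed
  \<comment> \<open>This common factor of both conformality equations is to be cancelled.\<close>
  have "inn (A (B x)) x \<noteq> 0"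
  proof
    assume "inn (A (B x)) x = 0"
    then have "P * Q * embed (inn x x) = 0"
      using embed_inner_implements[OF PQ implements_one, of x x] by simp
    then have "Z * (P * Q) * embed (inn x x) = 0" by (simp add: mult.assoc)
    then show False using inv x inner_eq_zero_iff[of x] by simp
  qed
  then show ?thesis using norm_inner_T[of "A x" "B x"] norm_inner_T[of "A (B x)" x] h k by simp
qed

lemma ratio_le:
  assumes x: "x \<noteq> 0" and Q: "implements Q B" "star Q = Q" "Z * Q = 1"
    and comm: "embed (inn x x) * Q = Q * embed (inn x x)"
      "embed (inn (T x) (T x)) * Q = Q * embed (inn (T x) (T x))"
  shows "ratio (B x) \<le> ratio x"
proof -
  have imp: "implements (Q ^ n) (B ^^ n)" for n
  proof (induction n)
    case 0 then show ?case using implements_one by (simp add: id_def)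
  next
    case (Suc n)
    then show ?case using implements_mult[OF Q(1) Suc] by (simp add: o_def)
  qed
  have inv: "Z ^ n * Q ^ n = 1" for n
  proof (induction n)
    case (Suc n)
    have "Z ^ Suc n * Q ^ Suc n = Z ^ n * (Z * Q) * Q ^ n"
      by (simp only: power_Suc[of Q] power_Suc2[of Z] mult.assoc)
    then show ?case by (simp add: Q(3) Suc)
  qed simp
  define q where "q = ratio (B x) / ratio x"
  have pow: "ratio ((B ^^ n) x) = ratio x * q ^ n" for n
  proof (induction n)
    case (Suc n)
    have "Z ^ Suc n * (Q ^ n * Q) = 1" using inv[of "Suc n"] by (simp only: power_Suc2)
    then have "ratio ((B ^^ n) x) * ratio (B x) = ratio ((B ^^ n) (B x)) * ratio x"
      by (rule ratio_mult[OF x imp Q(1,2) comm])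
    then show ?case using ratio_pos[OF x] by (simp add: Suc q_def funpow_swap1 field_simps)
  qed simp
  obtain K where K: "\<And>x. ratio x \<le> K" using ratio_bounded by blast
  have "q \<le> 1"
  proof (rule ccontr)
    assume "\<not> q \<le> 1"
    then obtain n where "K / ratio x < q ^ n" using real_arch_pow[of q] by auto
    then show False using K[of "(B ^^ n) x"] pow[of n] ratio_pos[OF x] by (simp add: divide_less_eq mult.commute)
  qed
  then show ?thesis using ratio_pos[OF x] by (simp add: q_def divide_le_eq)
qed

text \<open>The mutually inverse elements \<open>R\<close> and \<open>s\<close> commute with both
  inner squares, so neither can increase \<open>ratio x\<close>; their effects multiply to that of
  the identity, so both preserve it.\<close>

lemma inner_T_self: "inn (T x) (T x) = (ratio x)\<^sup>2 *\<^sub>R inn x x"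
proof (cases "x = 0")
  case False
  note x = False
  show ?thesis
  proof (rule inner_self_eq_scaleR[OF ratio_pos[OF x]])
    fix R s S S'
    assume R: "implements R S" "star R = R" and s: "implements s S'" "star s = s"
      and Rs: "R * s = 1" "s * R = 1"
      and comm: "\<And>c. c * embed (inn x x) = embed (inn x x) * c \<Longrightarrow>
        c * embed (inn (T x) (T x)) = embed (inn (T x) (T x)) * c \<Longrightarrow> c * R = R * c \<and> c * s = s * c"
    have c1: "embed (inn x x) * R = R * embed (inn x x) \<and> embed (inn x x) * s = s * embed (inn x x)"
      by (rule comm) (simp_all only: inner_T_commute)
    have c2: "embed (inn (T x) (T x)) * R = R * embed (inn (T x) (T x)) \<and>
        embed (inn (T x) (T x)) * s = s * embed (inn (T x) (T x))"
      by (rule comm) (simp_all only: inner_T_commute)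
    have leR: "ratio (S x) \<le> ratio x"
      by (rule ratio_le[OF x R Rs(2) c1[THEN conjunct1] c2[THEN conjunct1]])
    have les: "ratio (S' x) \<le> ratio x"
      by (rule ratio_le[OF x s Rs(1) c1[THEN conjunct2] c2[THEN conjunct2]])
    have "S (S' x) = x"
      using implements_unique[OF implements_mult[OF R(1) s(1)], of "\<lambda>x. x" x] implements_one Rs(1) by simp
    then have "ratio (S x) * ratio (S' x) = ratio x * ratio x"
      using ratio_mult[OF x R(1) s c1[THEN conjunct2] c2[THEN conjunct2], of 1] Rs(1) by simp
    moreover have "ratio (S x) * ratio (S' x) \<le> ratio (S x) * ratio x"
      using les ratio_nonneg by (rule mult_left_mono)
    ultimately have "ratio x \<le> ratio (S x)" using ratio_pos[OF x] by simp
    then show "norm (S (T x)) = ratio x * norm (S x)"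
      using leR norm_T[of "S x"] by (simp add: module_map_implements[OF module_map R(1), symmetric])
  qed
qed simp

text \<open>Approximate projection: \<open>a = \<langle>y, x\<rangle> (h + e)\<^sup>-\<^sup>1\<close> with \<open>h = \<langle>x, x\<rangle>\<close> makes \<open>y - a x\<close> nearly
  orthogonal to \<open>x\<close>, and \<open>T\<close> nearly preserves this.\<close>

lemma inner_T: "inn (T x) (T y) = (ratio x)\<^sup>2 *\<^sub>R inn x y"
proof -
  define L where "L = (ratio x)\<^sup>2"
  define g where "g = inn x y"
  obtain C where C: "C \<ge> 0" "\<And>x y. norm (inn (T x) (T y)) \<le> C * norm (inn x y)"
    by (rule norm_inner_T_le) blast
  define M where "M = (C + L) * (4 * norm y)"
  have L0: "L \<ge> 0" by (simp add: L_def)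
  then have M0: "M \<ge> 0" using C(1) by (simp add: M_def)
  have est: "norm (inn (T x) (T y) - L *\<^sub>R g) \<le> M * sqrt (2 * e)" if e: "e > 0" for e
  proof -
    define h where "h = embed (inn x x)"
    obtain v where v: "(h + e *\<^sub>R 1) * v = 1" "v * (h + e *\<^sub>R 1) = 1" "star v = v" "norm v \<le> 1 / e"
      unfolding h_def by (rule psd_add_scaleR_inverse[OF psd_embed_inner e]) blast
    obtain S where S: "implements v S"
      using implements_inverse[OF psd_embed_inner e] v(2) unfolding h_def by blast
    \<comment> \<open>\<open>c\<close> is \<open>(h + e)^-1 g\<close>; its adjoint \<open>a\<close>
      acts on \<open>x\<close>, because \<open>inn\<close> conjugates coefficients in the second
      variable.\<close>
    define c where "c = mop v g"
    define a where "a = star c"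
    have hv: "h * v = 1 - e *\<^sub>R v" using v(1) by (simp add: distrib_right eq_diff_eq)
    have "embed (g - inn x x * c) = embed g - h * v * embed g"
      by (simp add: embed_simps h_def c_def mult_embed[symmetric] mult.assoc)
    also have "\<dots> = e *\<^sub>R (v * embed g)" by (simp add: hv left_diff_distrib)
    also have "\<dots> = embed (e *\<^sub>R inn (S x) y)"
      using embed_inner_implements[OF S implements_one, of x y] by (simp add: g_def embed_simps)
    finally have gc: "g - inn x x * c = e *\<^sub>R inn (S x) y" by simp
    \<comment> \<open>The inner square of \<open>S x\<close> is
      \<open>v * h * v = v * (1 - e v)\<close>, of norm at most \<open>2 / e\<close>; so
      \<open>e * norm (S x)\<close> tends to \<open>0\<close> with \<open>e\<close>.\<close>
    have "(norm (S x))\<^sup>2 = norm (v * (1 - e *\<^sub>R v))"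
      using embed_inner_implements[OF S S, of x x] norm_embed[of "inn (S x) (S x)"]
      by (simp add: norm_squared_eq v(3) mult.assoc hv[symmetric] h_def)
    also have "\<dots> \<le> norm v * norm (1 - e *\<^sub>R v)" by (rule norm_mult_ineq)
    also have "\<dots> \<le> 1 / e * 2"
    proof (rule mult_mono[OF v(4)])
      have "norm (1 - e *\<^sub>R v) \<le> norm (1 :: 'a multiplier) + norm (e *\<^sub>R v)" by (rule norm_triangle_ineq4)
      moreover have "norm (e *\<^sub>R v) \<le> 1" using v(4) e by (simp add: field_simps)
      ultimately show "norm (1 - e *\<^sub>R v) \<le> 2" using norm_one_le[where 'a="'a multiplier"] by linarith
    qed (use e in simp_all)
    finally have "e\<^sup>2 * (norm (S x))\<^sup>2 \<le> e\<^sup>2 * (1 / e * 2)" by (rule mult_left_mono) simp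
    then have "(e * norm (S x))\<^sup>2 \<le> 2 * e" using e by (simp add: power_mult_distrib power2_eq_square mult_ac)
    then have eS: "e * norm (S x) \<le> sqrt (2 * e)" by (rule real_le_rsqrt)
    have "norm (g - inn x x * c) \<le> e * (4 * norm (S x) * norm y)"
      using gc norm_inner_le[of "S x" y] e by simp
    also have "\<dots> = (e * norm (S x)) * (4 * norm y)" by simp
    also have "\<dots> \<le> sqrt (2 * e) * (4 * norm y)" using eS by (rule mult_right_mono) simp
    finally have small: "norm (g - inn x x * c) \<le> sqrt (2 * e) * (4 * norm y)" .
    have "inn x (y - act a x) = g - inn x x * c"
      by (simp add: inner_diff_right inner_act_right a_def star_star g_def)
    moreover have "inn (T x) (T (y - act a x)) = inn (T x) (T y) - L *\<^sub>R (inn x x * c)"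
      by (simp add: T_diff T_act inner_diff_right inner_act_right a_def star_star inner_T_self L_def)
    ultimately have "norm (inn (T x) (T y) - L *\<^sub>R (inn x x * c)) \<le> C * norm (g - inn x x * c)"
      using C(2)[of x "y - act a x"] by simp
    then have "norm (inn (T x) (T y) - L *\<^sub>R (inn x x * c)) + norm (L *\<^sub>R (g - inn x x * c))
        \<le> (C + L) * norm (g - inn x x * c)"
      using L0 by (simp add: distrib_right)
    moreover have "inn (T x) (T y) - L *\<^sub>R g = (inn (T x) (T y) - L *\<^sub>R (inn x x * c)) - L *\<^sub>R (g - inn x x * c)"
      by (simp add: algebra_simps)
    ultimately have "norm (inn (T x) (T y) - L *\<^sub>R g) \<le> (C + L) * norm (g - inn x x * c)"
      by (metis norm_triangle_ineq4 order_trans)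
    also have "\<dots> \<le> (C + L) * (sqrt (2 * e) * (4 * norm y))"
      using small C(1) L0 by (intro mult_left_mono) simp_all
    finally show ?thesis by (simp add: M_def algebra_simps)
  qed
  have "norm (inn (T x) (T y) - L *\<^sub>R g) = 0"
  proof (rule ccontr)
    define d where "d = norm (inn (T x) (T y) - L *\<^sub>R g)"
    assume "norm (inn (T x) (T y) - L *\<^sub>R g) \<noteq> 0"
    then have d: "d > 0" by (simp add: d_def)
    \<comment> \<open>For this \<open>e\<close> the root \<open>sqrt (2 * e)\<close> is
      \<open>d / (M + 1)\<close>, and \<open>M / (M + 1) < 1\<close>.\<close>
    have "d \<le> M * sqrt (2 * ((d / (M + 1))\<^sup>2 / 2))"
      unfolding d_def[symmetric] using est[of "(d / (M + 1))\<^sup>2 / 2"] d M0 by (simp add: d_def)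
    then have "d \<le> M * (d / (M + 1))" using d M0 by simp
    then show False using d M0 by (simp add: field_simps)
  qed
  then show ?thesis by (simp add: L_def g_def)
qed

text \<open>Exchanging the arguments in \<open>inner_T\<close> shows that non-orthogonal vectors
  share their ratio; an orthogonal pair is linked through \<open>x + y\<close>.\<close>

lemma ratio_const:
  assumes "x \<noteq> 0" "y \<noteq> 0" shows "ratio x = ratio y"
proof -
  have non_orth: "ratio u = ratio w" if "inn u w \<noteq> 0" for u w
  proof -
    have "(ratio w)\<^sup>2 *\<^sub>R inn u w = star (inn (T w) (T u))"
      by (simp only: inner_T star_scaleR inner_commute[of u w])
    also have "\<dots> = (ratio u)\<^sup>2 *\<^sub>R inn u w" by (metis inner_T inner_commute)
    finally have "(ratio w)\<^sup>2 = (ratio u)\<^sup>2" using that by simp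
    then show ?thesis using ratio_nonneg by (simp add: power2_eq_iff_nonneg)
  qed
  show ?thesis
  proof (cases "inn x y = 0")
    case True
    then have "inn y x = 0" using inner_commute[of y x] by simp
    then have "inn x (x + y) \<noteq> 0" "inn y (x + y) \<noteq> 0"
      using True assms inner_eq_zero_iff by (simp_all add: inner_add_right)
    then show ?thesis using non_orth by metis
  qed (rule non_orth)
qed

end

section \<open>Conformal maps as positive multiples of isometries\<close>

theorem theorem2p3:
  fixes act :: "'a::cstar_algebra \<Rightarrow> 'm::complex_banach \<Rightarrow> 'm"
    and inn :: "'m \<Rightarrow> 'm \<Rightarrow> 'a"
    and T :: "'m \<Rightarrow> 'm"
  assumes "hilbert_module act inn"
    and "bounded_module_map act T"
    and "inj T"
  shows "conformal act inn T \<longleftrightarrow>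
    (\<exists>(l::real) U. l > 0 \<and> isometric_module_operator act U \<and> T = (\<lambda>x. l *\<^sub>R U x))"
proof
  interpret hilbert_module act inn by (rule assms(1))
  assume "conformal act inn T"
  then interpret conformal_map act inn T by unfold_locales
  obtain l where l: "l > 0" "\<And>x. norm (T x) = l * norm x"
  proof (cases "\<exists>z::'m. z \<noteq> 0")
    case True
    then obtain z :: 'm where z: "z \<noteq> 0" by blast
    have "norm (T x) = ratio z * norm x" for x
      using norm_T[of x] ratio_const[OF _ z, of x] by (cases "x = 0") simp_all
    then show ?thesis using that ratio_pos[OF z] by blast
  next
    \<comment> \<open>In the zero module any positive factor works; \<open>1\<close> is
      taken.\<close>
    case False
    show ?thesis
    proof (rule that[of 1])
      show "norm (T x) = 1 * norm x" for x using False by (metis T_zero mult_1)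
    qed simp
  qed
  define U where "U x = (1 / l) *\<^sub>R T x" for x
  have "act a (r *\<^sub>R x) = r *\<^sub>R act a x" for a r x
    by (metis act_scaleC_right scaleC_of_real)
  then have "isometric_module_operator act U"
    using l unfolding isometric_module_operator_def module_map_def U_def
    by (simp add: T_add T_scaleC T_act scaleR_add_right scaleC_scaleR)
  moreover have "T = (\<lambda>x. l *\<^sub>R U x)" using l(1) by (simp add: U_def)
  ultimately show "\<exists>(l::real) U. l > 0 \<and> isometric_module_operator act U \<and> T = (\<lambda>x. l *\<^sub>R U x)"
    using l(1) by blast
next
  interpret hilbert_module act inn by (rule assms(1))
  assume "\<exists>(l::real) U. l > 0 \<and> isometric_module_operator act U \<and> T = (\<lambda>x. l *\<^sub>R U x)"
  then obtain l U where l: "l > 0" and U: "isometric_module_operator act U" and T: "T = (\<lambda>x. l *\<^sub>R U x)"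
    by blast
  have "inn (l *\<^sub>R u) (l *\<^sub>R w) = (l * l) *\<^sub>R inn u w" for u w
    using inner_scaleC_left[of "of_real l" u] inner_scaleC_right[of _ "of_real l" w]
    by (simp add: scaleC_of_real)
  then have "inn (T x) (T y) = (l * l) *\<^sub>R inn x y" for x y
    by (simp add: T inner_isometric[OF U])
  moreover have "norm (T x) = l * norm x" for x
    using U l by (simp add: T isometric_module_operator_def)
  ultimately show "conformal act inn T"
    using l assms(2,3) by (simp add: conformal_def)
qed

end
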